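(* Let $d\in C^\infty$, $d\ge\mathrm{const}>0$, $\tau=\varepsilon t$, and let $$H(I,\phi,\tau,\varepsilon)=\frac{\pi^2I^2}{2d(\tau)^2}-\varepsilon\frac{I\,d'(\tau)}{d(\tau)}f(\phi),\qquad I>0,$$ with $f(\phi)=\phi$ for $\phi\in(0,\pi)$ and $f(\phi)=\phi-2\pi$ for $\phi\in(\pi,2\pi)$, extended $2\pi$-periodically. Let $r$ be any fixed natural number. Then there are functions $S_i(\hat I,\phi,\tau)$ and $\mathcal H_i(\hat I,\tau)$, $1\le i\le r-1$, with $S_i,\mathcal H_i$ of class $C^\infty$ in $\hat I,\tau$ and $S_i$ continuous with respect to the angle $\phi$, such that after the canonical change of variables $(I,\phi)\mapsto(\hat I,\hat\phi)$ with generating function $$W=\hat I\phi+\varepsilon S(\hat I,\phi,\tau,\varepsilon),\qquad S=S_1+\varepsilon S_2+\dots+\varepsilon^{r-2}S_{r-1},$$ the Hamiltonian takes the form $$\mathcal H=\mathcal H_{\Sigma,r}(\hat I,\tau,\varepsilon)+\varepsilon^{r}H_r(\hat I,\phi,\tau,\varepsilon),\qquad \mathcal H_{\Sigma,r}=E(\hat I,\tau)+\varepsilon\mathcal H_1+\dots+\varepsilon^{r-1}\mathcal H_{r-1},$$ where $\phi=\phi(\hat I,\hat\phi,\tau,\varepsilon)$, $E(\hat I,\tau)=\frac{\pi^2\hat I^2}{2d(\tau)^2}$, and $H_r=O(1)$ as $\varepsilon\to0$.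
   Context: The Hamiltonian $H$ describes, between impacts, a particle of mass $1$ moving freely between a fixed wall and a wall at distance $d(\varepsilon t)$, in action-angle variables $(I,\phi)$; $\varepsilon>0$ is a small parameter, the prime is $d/d\tau$, and $\phi$ is an angle variable (taken modulo $2\pi$). If the slow-time interval considered grows as $\varepsilon\to0$, $d$ and all its derivatives are assumed bounded on the real axis. The canonical change with generating function $W$ is defined by $$I=\hat I+\varepsilon\frac{\partial S}{\partial\phi},\qquad \hat\phi=\phi+\varepsilon\frac{\partial S}{\partial\hat I},$$ and the new Hamiltonian is $\mathcal H=H(I,\phi,\tau,\varepsilon)+\varepsilon^2\,\partial S(\hat I,\phi,\tau,\varepsilon)/\partial\tau$. For $r=1$ the sum $S$ is empty ($S=0$). The change is considered for $\varepsilon$ sufficiently small and for $\hat I$ in compact subsets of $(0,\infty)$; $O(1)$ is uniform there. *)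

theory Defs
  imports "HOL-Analysis.Analysis"
begin

text \<open>Iterated Frechet differentiability; meant for open \<open>X\<close>.\<close>

primrec higher_differentiable_on ::
  "nat \<Rightarrow> 'a::real_normed_vector set \<Rightarrow> ('a \<Rightarrow> 'b::real_normed_vector) \<Rightarrow> bool" where
  "higher_differentiable_on 0 X g \<longleftrightarrow> continuous_on X g"
| "higher_differentiable_on (Suc n) X g \<longleftrightarrow>
     (\<forall>x\<in>X. g differentiable (at x)) \<and>
     (\<forall>v. higher_differentiable_on n X (\<lambda>x. frechet_derivative g (at x) v))"

definition smooth_on :: "'a::real_normed_vector set \<Rightarrow> ('a \<Rightarrow> 'b::real_normed_vector) \<Rightarrow> bool" where
  "smooth_on X g \<longleftrightarrow> (\<forall>n. higher_differentiable_on n X g)"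

text \<open>The \<open>2\<pi>\<close>-periodic sawtooth. Its value at multiples of \<open>2\<pi>\<close> is the continuous one.
  At the jumps \<open>\<pi> + 2\<pi>k\<close> the value 0 is a dummy: those angles are the set \<open>jump_angles\<close>, at which
  the generating function need not be differentiable in the angle.\<close>

definition sawtooth :: "real \<Rightarrow> real" where
  "sawtooth \<phi> =
     (let \<psi> = 2 * pi * frac (\<phi> / (2 * pi))
      in if \<psi> < pi then \<psi> else if \<psi> > pi then \<psi> - 2 * pi else 0)"

definition jump_angles :: "real set" where
  "jump_angles = {\<phi>. \<exists>k::int. \<phi> = pi + 2 * pi * of_int k}"

definition energy :: "(real \<Rightarrow> real) \<Rightarrow> real \<Rightarrow> real \<Rightarrow> real" where
  "energy d I \<tau> = pi\<^sup>2 * I\<^sup>2 / (2 * (d \<tau>)\<^sup>2)"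

definition hamiltonian :: "(real \<Rightarrow> real) \<Rightarrow> real \<Rightarrow> real \<Rightarrow> real \<Rightarrow> real \<Rightarrow> real" where
  "hamiltonian d I \<phi> \<tau> \<epsilon> =
     pi\<^sup>2 * I\<^sup>2 / (2 * (d \<tau>)\<^sup>2) - \<epsilon> * (I * deriv d \<tau> / d \<tau>) * sawtooth \<phi>"

text \<open>The change of variables generated by \<open>W = J \<phi> + \<epsilon> S(J, \<phi>, \<tau>, \<epsilon>)\<close>, where \<open>J\<close> is the new
  action: \<open>I = \<partial>W/\<partial>\<phi>\<close> and the new angle is \<open>\<partial>W/\<partial>J\<close>. The function \<open>S\<close> takes its arguments in the
  order \<open>J\<close>, \<open>\<phi>\<close>, \<open>\<tau>\<close>, \<open>\<epsilon>\<close>. Angles are represented by their real lifts.\<close>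

definition old_action ::
  "(real \<Rightarrow> real \<Rightarrow> real \<Rightarrow> real \<Rightarrow> real) \<Rightarrow> real \<Rightarrow> real \<Rightarrow> real \<Rightarrow> real \<Rightarrow> real" where
  "old_action S \<tau> \<epsilon> J \<phi> = J + \<epsilon> * deriv (\<lambda>x. S J x \<tau> \<epsilon>) \<phi>"

definition new_angle ::
  "(real \<Rightarrow> real \<Rightarrow> real \<Rightarrow> real \<Rightarrow> real) \<Rightarrow> real \<Rightarrow> real \<Rightarrow> real \<Rightarrow> real \<Rightarrow> real" where
  "new_angle S \<tau> \<epsilon> J \<phi> = \<phi> + \<epsilon> * deriv (\<lambda>x. S x \<phi> \<tau> \<epsilon>) J"

definition old_angle ::
  "(real \<Rightarrow> real \<Rightarrow> real \<Rightarrow> real \<Rightarrow> real) \<Rightarrow> real \<Rightarrow> real \<Rightarrow> real \<Rightarrow> real \<Rightarrow> real" where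
  "old_angle S \<tau> \<epsilon> J \<psi> = inv (new_angle S \<tau> \<epsilon> J) \<psi>"

definition new_to_old ::
  "(real \<Rightarrow> real \<Rightarrow> real \<Rightarrow> real \<Rightarrow> real) \<Rightarrow> real \<Rightarrow> real \<Rightarrow> real \<times> real \<Rightarrow> real \<times> real" where
  "new_to_old S \<tau> \<epsilon> =
     (\<lambda>(J, \<psi>). (old_action S \<tau> \<epsilon> J (old_angle S \<tau> \<epsilon> J \<psi>), old_angle S \<tau> \<epsilon> J \<psi>))"

text \<open>\<open>S\<close> generates, for new actions in \<open>K\<close>, a genuine canonical change of variables: the partial
  derivatives used above exist, the relations can be solved for either pair of variables, the old
  action stays in the phase space \<open>I > 0\<close>, and the map from new to old variables has Jacobian
  determinant 1, which for one degree of freedom is symplecticity. All statements involving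
  \<open>\<partial>S/\<partial>\<phi>\<close> are for angles off \<open>jump_angles\<close>.\<close>

definition generates_canonical_change ::
  "(real \<Rightarrow> real \<Rightarrow> real \<Rightarrow> real \<Rightarrow> real) \<Rightarrow> real \<Rightarrow> real \<Rightarrow> real set \<Rightarrow> bool" where
  "generates_canonical_change S \<tau> \<epsilon> K \<longleftrightarrow>
     (\<forall>J\<in>K. \<forall>\<phi>. (\<lambda>x. S x \<phi> \<tau> \<epsilon>) differentiable (at J)) \<and>
     (\<forall>J\<in>K. \<forall>\<phi>. \<phi> \<notin> jump_angles \<longrightarrow> (\<lambda>x. S J x \<tau> \<epsilon>) differentiable (at \<phi>)) \<and>
     (\<forall>J\<in>K. bij (new_angle S \<tau> \<epsilon> J) \<and> continuous_on UNIV (new_angle S \<tau> \<epsilon> J)) \<and>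
     inj_on (\<lambda>(J, \<phi>). (old_action S \<tau> \<epsilon> J \<phi>, \<phi>)) (K \<times> - jump_angles) \<and>
     (\<forall>J\<in>K. \<forall>\<phi>. \<phi> \<notin> jump_angles \<longrightarrow> old_action S \<tau> \<epsilon> J \<phi> > 0) \<and>
     (\<forall>J\<in>K. \<forall>\<psi>. old_angle S \<tau> \<epsilon> J \<psi> \<notin> jump_angles \<longrightarrow>
        (\<exists>L. (new_to_old S \<tau> \<epsilon> has_derivative L) (at (J, \<psi>)) \<and>
             fst (L (1, 0)) * snd (L (0, 1)) - fst (L (0, 1)) * snd (L (1, 0)) = 1))"

text \<open>The Hamiltonian in the new variables, expressed through \<open>J\<close> and the old angle. The term
  \<open>\<partial>W/\<partial>t\<close> is \<open>\<epsilon>\<^sup>2 \<partial>S/\<partial>\<tau>\<close> because \<open>\<tau> = \<epsilon>t\<close>.\<close>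

definition new_hamiltonian ::
  "(real \<Rightarrow> real) \<Rightarrow> (real \<Rightarrow> real \<Rightarrow> real \<Rightarrow> real \<Rightarrow> real) \<Rightarrow>
   real \<Rightarrow> real \<Rightarrow> real \<Rightarrow> real \<Rightarrow> real" where
  "new_hamiltonian d S J \<phi> \<tau> \<epsilon> =
     hamiltonian d (old_action S \<tau> \<epsilon> J \<phi>) \<phi> \<tau> \<epsilon> + \<epsilon>\<^sup>2 * deriv (\<lambda>t. S J \<phi> t \<epsilon>) \<tau>"

definition generating_sum ::
  "nat \<Rightarrow> (nat \<Rightarrow> real \<Rightarrow> real \<Rightarrow> real \<Rightarrow> real) \<Rightarrow> real \<Rightarrow> real \<Rightarrow> real \<Rightarrow> real \<Rightarrow> real" where
  "generating_sum r S J \<phi> \<tau> \<epsilon> = (\<Sum>i=1..r-1. \<epsilon> ^ (i - 1) * S i J \<phi> \<tau>)"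

definition truncated_hamiltonian ::
  "(real \<Rightarrow> real) \<Rightarrow> nat \<Rightarrow> (nat \<Rightarrow> real \<Rightarrow> real \<Rightarrow> real) \<Rightarrow> real \<Rightarrow> real \<Rightarrow> real \<Rightarrow> real" where
  "truncated_hamiltonian d r h J \<tau> \<epsilon> = energy d J \<tau> + (\<Sum>i=1..r-1. \<epsilon> ^ i * h i J \<tau>)"

text \<open>Sets of slow times on which uniformity is claimed: any fixed bounded set, and arbitrary sets
  (e.g. intervals growing as \<open>\<epsilon> \<rightarrow> 0\<close>) if \<open>d\<close> and all its derivatives are bounded on the line.\<close>

definition admissible_times :: "(real \<Rightarrow> real) \<Rightarrow> real set \<Rightarrow> bool" where
  "admissible_times d T \<longleftrightarrow> bounded T \<or> (\<forall>n. bounded (range ((deriv ^^ n) d)))"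

end

theory Submission
  imports Defs
begin

text \<open>The proof is the classical averaging procedure, carried out one order in \<open>\<epsilon>\<close> at a time.

Suppose that a generating function \<open>S\<close> already brings the Hamiltonian into the form of an angle-free
part plus \<open>\<epsilon>\<^sup>n\<^sup>+\<^sup>1\<rho>\<close>. Adding \<open>\<epsilon>\<^sup>n u\<close> to \<open>S\<close> changes the Hamiltonian at order \<open>\<epsilon>\<^sup>n\<^sup>+\<^sup>1\<close> only by \<open>\<omega> u\<^sub>\<phi>\<close>, where
\<open>\<omega> = \<pi>\<^sup>2J/d\<^sup>2\<close> is the unperturbed frequency. One takes \<open>\<omega> u\<^sub>\<phi> = m - \<rho>\<^sub>0\<close> with \<open>\<rho>\<^sub>0\<close> the value of \<open>\<rho>\<close> at
\<open>\<epsilon> = 0\<close> and \<open>m\<close> its mean over the angle (\<open>homological_equation\<close>), so that the term of this order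
becomes the angle-free \<open>m\<close> and a new remainder of the next order is left (\<open>normal_form_step\<close>). The
mean being subtracted, \<open>u\<close> is continuous and periodic although \<open>\<rho>\<^sub>0\<close> jumps.

On \<open>(-\<pi>, \<pi>)\<close> the sawtooth is the identity. Hence all functions that arise are polynomials in the
angle \<open>x\<close> and in \<open>\<epsilon>\<close>, whose coefficients are polynomials in \<open>J\<close>, \<open>1/J\<close>, \<open>1/d\<close> and the derivatives of
\<open>d\<close>. This class, \<open>angle_poly\<close>, is closed under everything the procedure does: products,
derivatives, integration in \<open>x\<close>, and division of \<open>\<rho> - \<rho>\<^sub>0\<close> by \<open>\<epsilon>\<close>. Smoothness and uniform bounds are
therefore proved once for the class, and the transformed Hamiltonian satisfies an exact identity
instead of an expansion with an error to be estimated.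

It remains to see that \<open>S\<close> generates a canonical change of variables for small \<open>\<epsilon>\<close>
(\<open>wrapped_generating_function_is_canonical\<close>). For fixed \<open>J\<close> the new angle is \<open>\<phi> + \<epsilon> S\<^sub>J\<close>, where \<open>S\<^sub>J\<close>
is continuous, \<open>2\<pi>\<close>-periodic and piecewise smooth with bounded slope, so it is the lift of a circle
homeomorphism; the Jacobian is 1 because \<open>S\<^sub>J\<^sub>\<phi> = S\<^sub>\<phi>\<^sub>J\<close>.\<close>

section \<open>Smooth functions\<close>

lemma higher_differentiable_on_cong:
  assumes "open X" "higher_differentiable_on n X f" "\<And>x. x \<in> X \<Longrightarrow> f x = g x"
  shows "higher_differentiable_on n X g"
  using assms(2,3)
proof (induction n arbitrary: f g)
  case 0
  then show ?case using continuous_on_cong by (metis higher_differentiable_on.simps(1))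
next
  case (Suc n)
  have "g differentiable (at x)" if "x \<in> X" for x
    using Suc.prems that \<open>open X\<close>
    by (metis differentiable_def has_derivative_transform_within_open higher_differentiable_on.simps(2))
  moreover have "higher_differentiable_on n X (\<lambda>x. frechet_derivative g (at x) v)" for v
  proof (rule Suc.IH)
    show "higher_differentiable_on n X (\<lambda>x. frechet_derivative f (at x) v)"
      using Suc.prems by simp
    show "frechet_derivative f (at x) v = frechet_derivative g (at x) v" if "x \<in> X" for x
      using Suc.prems that \<open>open X\<close>
      by (metis frechet_derivative_transform_within_open higher_differentiable_on.simps(2))
  qed
  ultimately show ?case by simp
qed

text \<open>Smoothness of a whole class of functions at once: a class of differentiable functions that contains,
up to equality on \<open>X\<close>, all directional derivatives of its members consists of smooth functions.
This replaces separate closure properties of \<^const>\<open>smooth_on\<close> under sums, products and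
compositions.\<close>

lemma smooth_on_closed_class:
  assumes "open X" "P g"
    and closed: "\<And>g. P g \<Longrightarrow> (\<forall>x\<in>X. g differentiable (at x)) \<and>
      (\<forall>v. \<exists>g'. P g' \<and> (\<forall>x\<in>X. frechet_derivative g (at x) v = g' x))"
  shows "smooth_on X g"
proof -
  have "higher_differentiable_on n X g" if "P g" for n g
    using that
  proof (induction n arbitrary: g)
    case 0
    then show ?case
      using closed by (auto intro!: continuous_at_imp_continuous_on differentiable_imp_continuous_within)
  next
    case (Suc n)
    have "higher_differentiable_on n X (\<lambda>x. frechet_derivative g (at x) v)" for v
    proof -
      obtain g' where "P g'" "\<forall>x\<in>X. frechet_derivative g (at x) v = g' x"
        using closed Suc.prems by blast
      then show ?thesis
        using higher_differentiable_on_cong[OF \<open>open X\<close> Suc.IH[of g']] by simp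
    qed
    then show ?case using closed Suc.prems by simp
  qed
  then show ?thesis using \<open>P g\<close> by (simp add: smooth_on_def)
qed

lemma smooth_on_UNIV_has_iterated_deriv:
  fixes f :: "real \<Rightarrow> real"
  assumes "smooth_on UNIV f"
  shows "((deriv ^^ n) f has_real_derivative (deriv ^^ Suc n) f x) (at x)"
proof -
  have D: "(g has_real_derivative deriv g x) (at x)" if "smooth_on UNIV g" for g :: "real \<Rightarrow> real" and x
  proof -
    have "higher_differentiable_on (Suc 0) UNIV g"
      using that unfolding smooth_on_def by blast
    then have "g differentiable (at x)" by simp
    then show ?thesis
      using DERIV_deriv_iff_real_differentiable by blast
  qed
  have S: "smooth_on UNIV (deriv g)" if "smooth_on UNIV g" for g :: "real \<Rightarrow> real"
  proof -
    have eq: "frechet_derivative g (at x) 1 = deriv g x" for x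
      using D[OF that, of x] by (metis frechet_derivative_at has_field_derivative_imp_has_derivative mult.right_neutral)
    have "higher_differentiable_on n UNIV (deriv g)" for n
    proof -
      have "higher_differentiable_on (Suc n) UNIV g"
        using that unfolding smooth_on_def by blast
      then have "higher_differentiable_on n UNIV (\<lambda>x. frechet_derivative g (at x) 1)"
        by simp
      then show ?thesis by (simp add: eq)
    qed
    then show ?thesis by (simp add: smooth_on_def)
  qed
  have *: "smooth_on UNIV ((deriv ^^ n) f)"
    by (induction n) (auto simp: S assms)
  show "((deriv ^^ n) f has_real_derivative (deriv ^^ Suc n) f x) (at x)"
    using D[OF *] by simp
qed

section \<open>Angles\<close>

text \<open>The representative of an angle in \<open>[-\<pi>, \<pi>)\<close>. Off the jumps it coincides with the sawtooth. At a
jump it is \<open>-\<pi>\<close>, so that \<open>g (wrap \<phi>)\<close> is the continuous periodic extension of every continuous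
\<open>g\<close> on \<open>[-\<pi>, \<pi>]\<close> with equal end values; the sawtooth's value 0 would not allow this.\<close>

definition wrap :: "real \<Rightarrow> real" where
  "wrap \<phi> = \<phi> - 2 * pi * of_int \<lfloor>(\<phi> + pi) / (2 * pi)\<rfloor>"

lemma wrap_eqI:
  assumes "-pi \<le> x" "x < pi" "\<phi> = x + 2 * pi * of_int k"
  shows "wrap \<phi> = x"
proof -
  have "\<lfloor>(\<phi> + pi) / (2 * pi)\<rfloor> = k"
    using assms by (intro floor_unique) (auto simp: field_simps)
  then show ?thesis using assms by (simp add: wrap_def)
qed

lemma wrap_cases:
  obtains k :: int where "\<phi> = wrap \<phi> + 2 * pi * of_int k" "-pi \<le> wrap \<phi>" "wrap \<phi> < pi"
proof -
  define k where "k = \<lfloor>(\<phi> + pi) / (2 * pi)\<rfloor>"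
  have "of_int k \<le> (\<phi> + pi) / (2 * pi)" "(\<phi> + pi) / (2 * pi) < of_int k + 1"
    unfolding k_def by linarith+
  then have "2 * pi * of_int k \<le> \<phi> + pi" "\<phi> + pi < 2 * pi * (of_int k + 1)"
    by (auto simp: field_simps)
  moreover have "wrap \<phi> = \<phi> - 2 * pi * of_int k"
    by (simp add: wrap_def k_def)
  ultimately show ?thesis
    by (intro that[of k]) (auto simp: algebra_simps)
qed

lemma wrap_add_2pi [simp]: "wrap (\<phi> + 2 * pi) = wrap \<phi>"
proof (cases \<phi> rule: wrap_cases)
  case (1 k)
  then show ?thesis by (intro wrap_eqI[where k = "k + 1"]) (auto simp: algebra_simps)
qed

lemma wrap_eq_minus_pi_iff: "wrap \<phi> = -pi \<longleftrightarrow> \<phi> \<in> jump_angles"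
proof
  assume "wrap \<phi> = -pi"
  then obtain k :: int where "\<phi> = -pi + 2 * pi * of_int k" by (metis wrap_cases)
  then have "\<phi> = pi + 2 * pi * of_int (k - 1)" by (simp add: algebra_simps)
  then show "\<phi> \<in> jump_angles" unfolding jump_angles_def by blast
next
  assume "\<phi> \<in> jump_angles"
  then obtain k :: int where "\<phi> = pi + 2 * pi * of_int k" by (auto simp: jump_angles_def)
  then show "wrap \<phi> = -pi" by (intro wrap_eqI[where k = "k + 1"]) (auto simp: algebra_simps)
qed

lemma wrap_off_jumps:
  assumes "\<phi> \<notin> jump_angles"
  shows "-pi < wrap \<phi>" "wrap \<phi> < pi"
  using assms wrap_eq_minus_pi_iff[of \<phi>] by (cases \<phi> rule: wrap_cases; simp)+

lemma sawtooth_eq_wrap: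
  assumes "\<phi> \<notin> jump_angles"
  shows "sawtooth \<phi> = wrap \<phi>"
proof (cases \<phi> rule: wrap_cases)
  case (1 k)
  note b = wrap_off_jumps[OF assms]
  have frac: "2 * pi * frac (\<phi> / (2 * pi)) = \<phi> - 2 * pi * of_int \<lfloor>\<phi> / (2 * pi)\<rfloor>"
    by (simp add: frac_def right_diff_distrib)
  show ?thesis
  proof (cases "wrap \<phi> \<ge> 0")
    case True
    then have "\<lfloor>\<phi> / (2 * pi)\<rfloor> = k"
      using 1 b by (intro floor_unique) (auto simp: field_simps)
    then have "2 * pi * frac (\<phi> / (2 * pi)) = wrap \<phi>"
      using 1 by (simp add: frac)
    then show ?thesis using b by (simp add: sawtooth_def)
  next
    case False
    then have floor: "\<lfloor>\<phi> / (2 * pi)\<rfloor> = k - 1"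
      using 1 b by (intro floor_unique) (auto simp: field_simps)
    have "2 * pi * frac (\<phi> / (2 * pi)) = wrap \<phi> + 2 * pi"
      unfolding frac floor using 1(1) by (simp add: algebra_simps)
    then show ?thesis using b False by (simp add: sawtooth_def)
  qed
qed

text \<open>Off the jumps \<open>wrap\<close> is locally a translation; this is how differentiability passes from functions of
\<open>x\<close> on the line to functions of the angle.\<close>

lemma wrap_translation:
  assumes "\<phi> \<notin> jump_angles"
  obtains U c where "open U" "\<phi> \<in> U" "U \<inter> jump_angles = {}" "\<And>\<theta>. \<theta> \<in> U \<Longrightarrow> wrap \<theta> = \<theta> - c"
proof (cases \<phi> rule: wrap_cases)
  case (1 k)
  define U where "U = {2 * pi * of_int k - pi<..<2 * pi * of_int k + pi}"
  have w: "wrap \<theta> = \<theta> - 2 * pi * of_int k" if "\<theta> \<in> U" for \<theta>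
    using that by (intro wrap_eqI[where k = k]) (auto simp: U_def)
  then have "\<theta> \<notin> jump_angles" if "\<theta> \<in> U" for \<theta>
    using that wrap_eq_minus_pi_iff[of \<theta>] by (auto simp: U_def)
  moreover have "open U" "\<phi> \<in> U"
    using 1 wrap_off_jumps[OF assms] by (auto simp: U_def)
  ultimately show ?thesis using that w by blast
qed

text \<open>Every angle is interior to the union of two neighbouring closed periods, on each of which the
function is a translate of \<open>g\<close>; the right end point of a period is where the equality of the end
values enters.\<close>

lemma continuous_on_wrap:
  fixes g :: "real \<Rightarrow> 'a::topological_space"
  assumes g: "continuous_on {-pi..pi} g" and end_eq: "g pi = g (-pi)"
  shows "continuous_on UNIV (\<lambda>\<phi>. g (wrap \<phi>))"
proof -
  define I where "I k = {2 * pi * of_int k - pi..2 * pi * of_int k + pi}" for k :: int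
  have piece: "continuous_on (I k) (\<lambda>\<phi>. g (wrap \<phi>))" for k
  proof -
    have "continuous_on (I k) (\<lambda>\<phi>. g (\<phi> - 2 * pi * of_int k))"
      by (rule continuous_on_compose2[OF g]) (auto simp: I_def intro!: continuous_intros)
    moreover have "g (\<phi> - 2 * pi * of_int k) = g (wrap \<phi>)" if "\<phi> \<in> I k" for \<phi>
    proof (cases "\<phi> = 2 * pi * of_int k + pi")
      case True
      then have "wrap \<phi> = -pi"
        by (intro wrap_eqI[where k = "k + 1"]) (auto simp: algebra_simps)
      then show ?thesis using True end_eq by simp
    next
      case False
      then have "wrap \<phi> = \<phi> - 2 * pi * of_int k"
        using that by (intro wrap_eqI[where k = k]) (auto simp: I_def)
      then show ?thesis by simp
    qed
    ultimately show ?thesis by (simp cong: continuous_on_cong)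
  qed
  have "isCont (\<lambda>\<phi>. g (wrap \<phi>)) \<phi>" for \<phi>
  proof (cases \<phi> rule: wrap_cases)
    case (1 k)
    have "I (k - 1) \<union> I k = {2 * pi * of_int k - 3 * pi..2 * pi * of_int k + pi}"
      by (auto simp: I_def algebra_simps)
    moreover have "continuous_on (I (k - 1) \<union> I k) (\<lambda>\<phi>. g (wrap \<phi>))"
      by (intro continuous_on_closed_Un piece) (auto simp: I_def)
    moreover have "\<phi> \<in> interior {2 * pi * of_int k - 3 * pi..2 * pi * of_int k + pi}"
      using 1 pi_gt_zero by (simp del: pi_gt_zero)
    ultimately show ?thesis using continuous_on_interior by metis
  qed
  then show ?thesis by (simp add: continuous_at_imp_continuous_on)
qed

text \<open>The lift of a circle homeomorphism: \<open>n\<close> maps \<open>[-\<pi>, \<pi>)\<close> bijectively onto a half-open interval of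
length \<open>2\<pi>\<close>, and the translates of such an interval by multiples of \<open>2\<pi>\<close> partition the line.\<close>

lemma bij_wrap_lift:
  assumes cont: "continuous_on {-pi..pi} n" and mono: "strict_mono_on {-pi..pi} n"
    and turn: "n pi = n (-pi) + 2 * pi"
  shows "bij (\<lambda>\<phi>. n (wrap \<phi>) + (\<phi> - wrap \<phi>))" (is "bij ?N")
proof (rule bijI)
  have range: "n (-pi) \<le> n x" "n x < n (-pi) + 2 * pi" if "-pi \<le> x" "x < pi" for x
  proof -
    have "n (-pi) \<le> n x"
      using that strict_mono_onD[OF mono, of "-pi" x] by (cases "x = -pi") auto
    moreover have "n x < n pi"
      using that strict_mono_onD[OF mono, of x pi] by auto
    ultimately show "n (-pi) \<le> n x" "n x < n (-pi) + 2 * pi" using turn by auto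
  qed
  show "inj ?N"
  proof (rule injI)
    fix \<phi> \<theta> assume eq: "?N \<phi> = ?N \<theta>"
    obtain k :: int where k: "\<phi> = wrap \<phi> + 2 * pi * of_int k" "-pi \<le> wrap \<phi>" "wrap \<phi> < pi"
      by (rule wrap_cases)
    obtain l :: int where l: "\<theta> = wrap \<theta> + 2 * pi * of_int l" "-pi \<le> wrap \<theta>" "wrap \<theta> < pi"
      by (rule wrap_cases)
    have diff: "n (wrap \<phi>) - n (wrap \<theta>) = 2 * pi * of_int (l - k)"
      using eq k(1) l(1) by (simp add: algebra_simps)
    have "\<bar>2 * pi * of_int (l - k)\<bar> < 2 * pi * 1"
      unfolding diff[symmetric] using range[OF k(2,3)] range[OF l(2,3)] by linarith
    then have "\<bar>of_int (l - k) :: real\<bar> < 1"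
      by (simp add: abs_mult)
    then have "l = k" by linarith
    then have "n (wrap \<phi>) = n (wrap \<theta>)" using diff by simp
    then have "wrap \<phi> = wrap \<theta>"
      using strict_mono_on_imp_inj_on[OF mono] k l by (auto dest!: inj_onD)
    then show "\<phi> = \<theta>" using k(1) l(1) \<open>l = k\<close> by simp
  qed
  show "surj ?N"
  proof (rule surjI)
    fix \<psi>
    define k where "k = \<lfloor>(\<psi> - n (-pi)) / (2 * pi)\<rfloor>"
    have "of_int k \<le> (\<psi> - n (-pi)) / (2 * pi)" "(\<psi> - n (-pi)) / (2 * pi) < of_int k + 1"
      unfolding k_def by linarith+
    then have b: "n (-pi) \<le> \<psi> - 2 * pi * of_int k" "\<psi> - 2 * pi * of_int k < n pi"
      using turn by (auto simp: field_simps)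
    then obtain x where x: "-pi \<le> x" "x \<le> pi" "n x = \<psi> - 2 * pi * of_int k"
      using IVT'[OF _ _ _ cont] by fastforce
    then have "x < pi" using b by (cases "x = pi") auto
    then have "wrap (x + 2 * pi * of_int k) = x"
      using x by (intro wrap_eqI) auto
    then show "?N (SOME \<phi>. ?N \<phi> = \<psi>) = \<psi>"
      using x by (intro someI[of "\<lambda>\<phi>. ?N \<phi> = \<psi>" "x + 2 * pi * of_int k"]) simp
  qed
qed

lemma DERIV_wrap:
  assumes \<phi>: "\<phi> \<notin> jump_angles" and f: "(f has_real_derivative D) (at (wrap \<phi>))"
  shows "((\<lambda>\<theta>. f (wrap \<theta>)) has_real_derivative D) (at \<phi>)"
proof -
  obtain U c where U: "open U" "\<phi> \<in> U" "\<And>\<theta>. \<theta> \<in> U \<Longrightarrow> wrap \<theta> = \<theta> - c"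
    using wrap_translation[OF \<phi>] by metis
  have "((\<lambda>\<theta>. \<theta> - c) has_real_derivative 1) (at \<phi>)"
    by (auto intro!: derivative_eq_intros)
  from DERIV_chain2[OF f[unfolded U(3)[OF U(2)]] this]
  have "((\<lambda>\<theta>. f (\<theta> - c)) has_real_derivative D) (at \<phi>)" by simp
  then show ?thesis
    by (rule has_field_derivative_transform_within_open[OF _ U(1,2)]) (simp add: U(3))
qed

section \<open>Gradients in the plane\<close>

text \<open>Used for functions of \<open>(J, x)\<close> and of \<open>(J, \<tau>)\<close>; the gradient is given by its two entries, so that
the equality of mixed derivatives can be expressed by a shared entry.\<close>

definition has_gradient ::
  "(real \<Rightarrow> real \<Rightarrow> real) \<Rightarrow> real \<Rightarrow> real \<Rightarrow> real \<Rightarrow> real \<Rightarrow> bool" where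
  "has_gradient g gJ gx J x \<longleftrightarrow>
    ((\<lambda>(J, x). g J x) has_derivative (\<lambda>(u, v). u * gJ + v * gx)) (at (J, x))"

lemma has_gradient_add:
  assumes "has_gradient g gJ gx J x" "has_gradient h hJ hx J x"
  shows "has_gradient (\<lambda>J x. g J x + h J x) (gJ + hJ) (gx + hx) J x"
  using has_derivative_add[OF assms[unfolded has_gradient_def]]
  by (simp add: has_gradient_def case_prod_unfold algebra_simps)

lemma has_gradient_partials:
  assumes "has_gradient g gJ gx J x"
  shows "((\<lambda>J. g J x) has_real_derivative gJ) (at J)"
    and "((\<lambda>x. g J x) has_real_derivative gx) (at x)"
proof -
  have "((\<lambda>J. (J, x)) has_derivative (\<lambda>u. (u, 0))) (at J)"
    by (auto intro!: derivative_eq_intros)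
  from has_derivative_compose[OF this assms[unfolded has_gradient_def]]
  show "((\<lambda>J. g J x) has_real_derivative gJ) (at J)"
    by (simp add: has_field_derivative_def mult_commute_abs)
  have "((\<lambda>x. (J, x)) has_derivative (\<lambda>v. (0, v))) (at x)"
    by (auto intro!: derivative_eq_intros)
  from has_derivative_compose[OF this assms[unfolded has_gradient_def]]
  show "((\<lambda>x. g J x) has_real_derivative gx) (at x)"
    by (simp add: has_field_derivative_def mult_commute_abs)
qed

lemma has_gradient_monomial:
  assumes "((\<lambda>J. b J) has_real_derivative bJ) (at J)"
  shows "has_gradient (\<lambda>J x. b J * x ^ k * e) (bJ * x ^ k * e) (k * b J * x ^ (k - 1) * e) J x"
proof -
  have "((\<lambda>p. b (fst p)) has_derivative (\<lambda>w. bJ * fst w)) (at (J, x))"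
    by (rule has_derivative_compose[of fst fst, where g = "\<lambda>J. b J"])
      (use assms in \<open>auto intro!: derivative_eq_intros simp: has_field_derivative_def\<close>)
  then have "((\<lambda>p. b (fst p) * snd p ^ k * e) has_derivative
      (\<lambda>w. fst w * (bJ * x ^ k * e) + snd w * (k * b J * x ^ (k - 1) * e))) (at (J, x))"
    by (auto intro!: derivative_eq_intros simp: algebra_simps)
  then show ?thesis by (simp add: has_gradient_def case_prod_unfold)
qed

lemma has_gradient_shift:
  assumes "has_gradient g gJ gx J (x - c)"
  shows "has_gradient (\<lambda>J x. g J (x - c)) gJ gx J x"
proof -
  have "((\<lambda>p. (fst p, snd p - c)) has_derivative (\<lambda>w. w)) (at (J, x))"
    by (auto intro!: derivative_eq_intros)
  moreover have "((\<lambda>p. g (fst p) (snd p)) has_derivative (\<lambda>w. fst w * gJ + snd w * gx))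
      (at (fst (J, x), snd (J, x) - c))"
    using assms by (simp add: has_gradient_def case_prod_unfold)
  ultimately have "((\<lambda>p. g (fst p) (snd p - c)) has_derivative (\<lambda>w. fst w * gJ + snd w * gx)) (at (J, x))"
    using has_derivative_compose by fastforce
  then show ?thesis by (simp add: has_gradient_def case_prod_unfold)
qed

section \<open>Canonical transformations from periodic generating functions\<close>

text \<open>At a fixed time and a fixed \<open>\<epsilon>\<close>, let \<open>S = s(J, wrap \<phi>)\<close>. If \<open>\<bar>\<epsilon> s\<^sub>J\<^sub>x\<bar> < 1\<close> on a rectangle of
actions and angles, then both \<open>x \<mapsto> x + \<epsilon> s\<^sub>J(J, x)\<close> and \<open>J \<mapsto> J + \<epsilon> s\<^sub>x(J, x)\<close> have the positive
derivative \<open>1 + \<epsilon> s\<^sub>J\<^sub>x\<close>, so both generating relations can be solved, while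
\<open>\<bar>\<epsilon> s\<^sub>x\<bar> < a\<close> keeps the old action positive. The Jacobian is 1 for the usual
reason: \<open>(J, \<psi>) \<mapsto> (J, \<phi>)\<close> has determinant \<open>1 / (1 + \<epsilon> s\<^sub>J\<^sub>x)\<close> and \<open>(J, \<phi>) \<mapsto> (I, \<phi>)\<close> has determinant
\<open>1 + \<epsilon> s\<^sub>x\<^sub>J\<close>, and the mixed derivatives agree. The set \<open>K\<close> need not be convex, hence the monotonicity
arguments take place in a surrounding interval \<open>[a, b]\<close>; because \<open>K\<close> lies in
its interior, the inverse of the new angle is available around every action in \<open>K\<close>, as
differentiation of the change of variables requires.\<close>

lemma wrapped_generating_function_is_canonical:
  fixes s sJ sx sJJ sJx sxx :: "real \<Rightarrow> real \<Rightarrow> real"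
    and S :: "real \<Rightarrow> real \<Rightarrow> real \<Rightarrow> real \<Rightarrow> real"
  assumes S: "\<And>J \<phi>. S J \<phi> \<tau> \<epsilon> = s J (wrap \<phi>)"
    and s: "\<And>J x. J > 0 \<Longrightarrow> has_gradient s (sJ J x) (sx J x) J x"
    and sJ: "\<And>J x. J > 0 \<Longrightarrow> has_gradient sJ (sJJ J x) (sJx J x) J x"
    and sx: "\<And>J x. J > 0 \<Longrightarrow> has_gradient sx (sJx J x) (sxx J x) J x"
    and periodic: "\<And>J. J > 0 \<Longrightarrow> s J pi = s J (-pi)"
    and K: "0 < a" "K \<subseteq> {a<..<b}"
    and small: "\<And>J x. \<lbrakk>a \<le> J; J \<le> b; -pi \<le> x; x \<le> pi\<rbrakk> \<Longrightarrow> \<bar>\<epsilon> * sJx J x\<bar> < 1"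
      "\<And>J x. \<lbrakk>a \<le> J; J \<le> b; -pi \<le> x; x \<le> pi\<rbrakk> \<Longrightarrow> \<bar>\<epsilon> * sx J x\<bar> < a"
  shows "generates_canonical_change S \<tau> \<epsilon> K"
proof -
  have wrap_range: "-pi \<le> wrap \<phi>" "wrap \<phi> \<le> pi" for \<phi>
    by (cases \<phi> rule: wrap_cases; simp)+
  have DJ: "((\<lambda>x. S x \<phi> \<tau> \<epsilon>) has_real_derivative sJ J (wrap \<phi>)) (at J)" if "J > 0" for J \<phi>
    unfolding S by (rule has_gradient_partials[OF s[OF that]])
  have D\<phi>: "((\<lambda>x. S J x \<tau> \<epsilon>) has_real_derivative sx J (wrap \<phi>)) (at \<phi>)"
    if J: "J > 0" and \<phi>: "\<phi> \<notin> jump_angles" for J \<phi>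
    unfolding S by (rule DERIV_wrap[OF \<phi> has_gradient_partials(2)[OF s[OF J]]])
  have new_angle: "new_angle S \<tau> \<epsilon> J \<phi> = \<phi> + \<epsilon> * sJ J (wrap \<phi>)" if "J > 0" for J \<phi>
    unfolding new_angle_def by (simp add: DERIV_imp_deriv[OF DJ[OF that]])
  have old_action: "old_action S \<tau> \<epsilon> J \<phi> = J + \<epsilon> * sx J (wrap \<phi>)"
    if "J > 0" "\<phi> \<notin> jump_angles" for J \<phi>
    unfolding old_action_def by (simp add: DERIV_imp_deriv[OF D\<phi>[OF that]])
  have sJ_periodic: "sJ J pi = sJ J (-pi)" if "J > 0" for J
  proof (rule DERIV_unique)
    show "((\<lambda>J. s J pi) has_real_derivative sJ J pi) (at J)"
      by (rule has_gradient_partials[OF s[OF that]])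
    show "((\<lambda>J. s J pi) has_real_derivative sJ J (-pi)) (at J)"
      by (rule has_field_derivative_transform_within_open
          [OF has_gradient_partials(1)[OF s[OF that, of "-pi"]], of "{0<..}"])
        (use that periodic in auto)
  qed
  have cont_sJ: "continuous_on A (\<lambda>x. sJ J x)" if "J > 0" for J A
    by (rule DERIV_continuous_on)
      (rule has_field_derivative_at_within[OF has_gradient_partials(2)[OF sJ[OF that]]])
  have cont_n: "continuous_on A (\<lambda>x. x + \<epsilon> * sJ J x)" if "J > 0" for J A
    by (intro continuous_on_add continuous_on_id continuous_on_mult continuous_on_const cont_sJ that)
  \<comment> \<open>The new angle commutes with rotation by \<open>2\<pi>\<close>, which puts it into the form of a circle map lift.\<close>
  have lift: "new_angle S \<tau> \<epsilon> J = (\<lambda>\<phi>. (wrap \<phi> + \<epsilon> * sJ J (wrap \<phi>)) + (\<phi> - wrap \<phi>))"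
    if "J > 0" for J
    using new_angle[OF that] by auto
  have bij: "bij (new_angle S \<tau> \<epsilon> J)" if J: "a \<le> J" "J \<le> b" for J
    unfolding lift[OF less_le_trans[OF K(1) J(1)]]
  proof (rule bij_wrap_lift)
    have "J > 0" using J K by linarith
    then show "continuous_on {-pi..pi} (\<lambda>x. x + \<epsilon> * sJ J x)"
      "pi + \<epsilon> * sJ J pi = (-pi) + \<epsilon> * sJ J (-pi) + 2 * pi"
      using cont_n sJ_periodic by auto
    show "strict_mono_on {-pi..pi} (\<lambda>x. x + \<epsilon> * sJ J x)"
    proof (rule strict_mono_onI)
      fix x y assume xy: "x \<in> {-pi..pi}" "y \<in> {-pi..pi}" "x < y"
      show "x + \<epsilon> * sJ J x < y + \<epsilon> * sJ J y"
      proof (rule DERIV_pos_imp_increasing[OF xy(3)])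
        fix z assume z: "x \<le> z" "z \<le> y"
        have "((\<lambda>x. x + \<epsilon> * sJ J x) has_real_derivative 1 + \<epsilon> * sJx J z) (at z)"
          by (intro DERIV_add DERIV_ident DERIV_cmult has_gradient_partials(2)[OF sJ[OF \<open>J > 0\<close>]])
        moreover have "\<bar>\<epsilon> * sJx J z\<bar> < 1"
          using xy z J by (intro small) auto
        then have "1 + \<epsilon> * sJx J z > 0" by linarith
        ultimately show "\<exists>y. ((\<lambda>x. x + \<epsilon> * sJ J x) has_real_derivative y) (at z) \<and> 0 < y"
          by blast
      qed
    qed
  qed
  have cont: "continuous_on UNIV (new_angle S \<tau> \<epsilon> J)" if "J > 0" for J
  proof -
    have "continuous_on UNIV (\<lambda>\<phi>. sJ J (wrap \<phi>))"
      by (rule continuous_on_wrap[OF cont_sJ[OF that] sJ_periodic[OF that]])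
    then have "continuous_on UNIV (\<lambda>\<phi>. \<phi> + \<epsilon> * sJ J (wrap \<phi>))"
      by (intro continuous_on_add continuous_on_id continuous_on_mult continuous_on_const)
    then show ?thesis
      by (simp add: new_angle[OF that])
  qed
  have action_mono: "J + \<epsilon> * sx J x < J' + \<epsilon> * sx J' x"
    if J: "a \<le> J" "J < J'" "J' \<le> b" and x: "-pi \<le> x" "x \<le> pi" for J J' x
  proof (rule DERIV_pos_imp_increasing[OF J(2)])
    fix z assume z: "J \<le> z" "z \<le> J'"
    then have "z > 0" using J K by linarith
    then have "((\<lambda>J. J + \<epsilon> * sx J x) has_real_derivative 1 + \<epsilon> * sJx z x) (at z)"
      by (intro DERIV_add DERIV_ident DERIV_cmult has_gradient_partials(1)[OF sx])
    moreover have "\<bar>\<epsilon> * sJx z x\<bar> < 1"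
      using x z J by (intro small) auto
    then have "1 + \<epsilon> * sJx z x > 0" by linarith
    ultimately show "\<exists>y. ((\<lambda>J. J + \<epsilon> * sx J x) has_real_derivative y) (at z) \<and> 0 < y"
      by blast
  qed
  have K_pos: "a < J" "J < b" "J > 0" if "J \<in> K" for J
    using that K by auto
  have symplectic: "\<exists>L. (new_to_old S \<tau> \<epsilon> has_derivative L) (at (J, \<psi>)) \<and>
      fst (L (1, 0)) * snd (L (0, 1)) - fst (L (0, 1)) * snd (L (1, 0)) = 1"
    if J: "J \<in> K" and off: "old_angle S \<tau> \<epsilon> J \<psi> \<notin> jump_angles" for J \<psi>
  proof -
    define \<phi> where "\<phi> = old_angle S \<tau> \<epsilon> J \<psi>"
    obtain U c where U: "open U" "\<phi> \<in> U" "U \<inter> jump_angles = {}" "\<And>\<theta>. \<theta> \<in> U \<Longrightarrow> wrap \<theta> = \<theta> - c"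
      using wrap_translation off \<phi>_def by metis
    define \<Omega> where "\<Omega> = {a<..<b} \<times> U"
    have \<Omega>: "open \<Omega>" "(J, \<phi>) \<in> \<Omega>"
      using U J K by (auto simp: \<Omega>_def intro!: open_Times)
    define x where "x = \<phi> - c"
    have x: "x = wrap \<phi>" using U by (simp add: x_def)
    \<comment> \<open>The new variables are expressed through \<open>(J, \<phi>)\<close> by \<open>F\<close>, with inverse \<open>G\<close>, and the old ones by \<open>Q\<close>.
      Near \<open>(J, \<phi>)\<close> the function \<open>wrap\<close> is a translation, which turns \<open>Q\<close> into the explicit \<open>P\<close>.\<close>
    define F where "F = (\<lambda>p. (fst p, snd p + \<epsilon> * sJ (fst p) (snd p - c)))"
    define G where "G = (\<lambda>p. (fst p, old_angle S \<tau> \<epsilon> (fst p) (snd p)))"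
    define P where "P = (\<lambda>p. (fst p + \<epsilon> * sx (fst p) (snd p - c), snd p))"
    define Q where "Q = (\<lambda>p. (old_action S \<tau> \<epsilon> (fst p) (snd p), snd p))"
    have DF: "(F has_derivative (\<lambda>w. (fst w, snd w + \<epsilon> * (fst w * sJJ I (\<theta> - c) + snd w * sJx I (\<theta> - c))))) (at (I, \<theta>))"
      if "I > 0" for I \<theta>
      using has_gradient_shift[OF sJ[OF that, of "\<theta> - c"]]
      unfolding F_def has_gradient_def case_prod_unfold
      by (auto intro!: derivative_eq_intros)
    have DP: "(P has_derivative (\<lambda>w. (fst w + \<epsilon> * (fst w * sJx I (\<theta> - c) + snd w * sxx I (\<theta> - c)), snd w))) (at (I, \<theta>))"
      if "I > 0" for I \<theta>
      using has_gradient_shift[OF sx[OF that, of "\<theta> - c"]]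
      unfolding P_def has_gradient_def case_prod_unfold
      by (auto intro!: derivative_eq_intros)
    define \<alpha> where "\<alpha> = \<epsilon> * sJJ J x"
    define \<beta> where "\<beta> = 1 + \<epsilon> * sJx J x"
    define \<gamma> where "\<gamma> = \<epsilon> * sxx J x"
    have "\<bar>\<epsilon> * sJx J x\<bar> < 1"
      using K_pos[OF J] wrap_range[of \<phi>] by (intro small) (auto simp: x)
    then have \<beta>: "\<beta> \<noteq> 0" by (auto simp: \<beta>_def)
    have F_eq: "F (I, \<theta>) = (I, new_angle S \<tau> \<epsilon> I \<theta>)" if "(I, \<theta>) \<in> \<Omega>" for I \<theta>
      using that K U(4)[of \<theta>] new_angle[of I \<theta>] by (auto simp: F_def \<Omega>_def)
    \<comment> \<open>The Jacobian matrix of \<open>F\<close> is triangular with diagonal \<open>1, \<beta>\<close>.\<close>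
    have "(G has_derivative (\<lambda>w. (fst w, (snd w - \<alpha> * fst w) / \<beta>))) (at (F (J, \<phi>)))"
    proof (rule has_derivative_inverse_strong[OF \<Omega>])
      show "continuous_on \<Omega> F"
      proof (intro continuous_at_imp_continuous_on ballI)
        fix p assume "p \<in> \<Omega>"
        then show "isCont F p"
          using has_derivative_continuous[OF DF[of "fst p" "snd p"]] K by (auto simp: \<Omega>_def)
      qed
      show "G (F p) = p" if "p \<in> \<Omega>" for p
        using F_eq[of "fst p" "snd p"] that K bij[of "fst p"]
        by (auto simp: G_def \<Omega>_def old_angle_def bij_is_inj inv_f_f)
      show "(F has_derivative (\<lambda>w. (fst w, \<alpha> * fst w + \<beta> * snd w))) (at (J, \<phi>))"
        using DF[OF K_pos(3)[OF J], of \<phi>]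
        by (simp add: \<alpha>_def \<beta>_def x_def algebra_simps)
      show "(\<lambda>w. (fst w, \<alpha> * fst w + \<beta> * snd w)) \<circ> (\<lambda>w. (fst w, (snd w - \<alpha> * fst w) / \<beta>)) = id"
        using \<beta> by (auto simp: fun_eq_iff)
    qed
    moreover have "F (J, \<phi>) = (J, \<psi>)"
      using F_eq[OF \<Omega>(2)] bij[of J] K_pos[OF J]
      by (simp add: \<phi>_def old_angle_def bij_is_surj surj_f_inv_f)
    ultimately have DG: "(G has_derivative (\<lambda>w. (fst w, (snd w - \<alpha> * fst w) / \<beta>))) (at (J, \<psi>))"
      by simp
    have "(P has_derivative (\<lambda>w. (\<beta> * fst w + \<gamma> * snd w, snd w))) (at (J, \<phi>))"
      using DP[OF K_pos(3)[OF J], of \<phi>]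
      by (simp add: \<gamma>_def \<beta>_def x_def algebra_simps)
    then have "(Q has_derivative (\<lambda>w. (\<beta> * fst w + \<gamma> * snd w, snd w))) (at (J, \<phi>))"
    proof (rule has_derivative_transform_within_open[OF _ \<Omega>])
      show "P p = Q p" if "p \<in> \<Omega>" for p
      proof -
        have "snd p \<notin> jump_angles" "fst p > 0" using that U(3) K by (auto simp: \<Omega>_def)
        then show ?thesis
          using that U(4) old_action by (auto simp: P_def Q_def \<Omega>_def)
      qed
    qed
    moreover have "G (J, \<psi>) = (J, \<phi>)" by (simp add: G_def \<phi>_def)
    ultimately have "((\<lambda>p. Q (G p)) has_derivative
        (\<lambda>w. (\<beta> * fst w + \<gamma> * ((snd w - \<alpha> * fst w) / \<beta>), (snd w - \<alpha> * fst w) / \<beta>))) (at (J, \<psi>))"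
      using has_derivative_compose[OF DG] by fastforce
    moreover have "new_to_old S \<tau> \<epsilon> = (\<lambda>p. Q (G p))"
      by (auto simp: new_to_old_def Q_def G_def fun_eq_iff)
    ultimately show ?thesis
      using \<beta> by (intro exI conjI, simp) (simp add: field_simps)
  qed
  show ?thesis
    unfolding generates_canonical_change_def
  proof (intro conjI ballI allI impI)
    fix J \<phi> assume "J \<in> K"
    then show "(\<lambda>x. S x \<phi> \<tau> \<epsilon>) differentiable (at J)"
      using DJ[of J \<phi>] K_pos real_differentiable_def by blast
  next
    fix J \<phi> assume "J \<in> K" "\<phi> \<notin> jump_angles"
    then show "(\<lambda>x. S J x \<tau> \<epsilon>) differentiable (at \<phi>)"
      using D\<phi>[of J \<phi>] K_pos real_differentiable_def by blast
  next
    fix J assume "J \<in> K"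
    then show "bij (new_angle S \<tau> \<epsilon> J)" "continuous_on UNIV (new_angle S \<tau> \<epsilon> J)"
      using bij[of J] cont[of J] K_pos[of J] by auto
  next
    show "inj_on (\<lambda>(J, \<phi>). (old_action S \<tau> \<epsilon> J \<phi>, \<phi>)) (K \<times> - jump_angles)"
    proof (rule inj_onI)
      fix p q :: "real \<times> real"
      assume "p \<in> K \<times> - jump_angles" "q \<in> K \<times> - jump_angles"
        and "(case p of (J, \<phi>) \<Rightarrow> (old_action S \<tau> \<epsilon> J \<phi>, \<phi>)) = (case q of (J, \<phi>) \<Rightarrow> (old_action S \<tau> \<epsilon> J \<phi>, \<phi>))"
      then obtain J J' \<phi> where pq: "p = (J, \<phi>)" "q = (J', \<phi>)"
        and J: "J \<in> K" "J' \<in> K" "\<phi> \<notin> jump_angles"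
        and eq: "old_action S \<tau> \<epsilon> J \<phi> = old_action S \<tau> \<epsilon> J' \<phi>"
        by (cases p; cases q) auto
      then have "J + \<epsilon> * sx J (wrap \<phi>) = J' + \<epsilon> * sx J' (wrap \<phi>)"
        using old_action K_pos by auto
      then have "J = J'"
        using action_mono[of J J' "wrap \<phi>"] action_mono[of J' J "wrap \<phi>"] wrap_range[of \<phi>]
          K_pos[OF J(1)] K_pos[OF J(2)] by (cases rule: linorder_cases[of J J']) auto
      then show "p = q" using pq by simp
    qed
  next
    fix J \<phi> assume J: "J \<in> K" "\<phi> \<notin> jump_angles"
    have "\<bar>\<epsilon> * sx J (wrap \<phi>)\<bar> < a"
      using K_pos[OF J(1)] wrap_range[of \<phi>] by (intro small) auto
    then show "old_action S \<tau> \<epsilon> J \<phi> > 0"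
      using old_action[OF K_pos(3)[OF J(1)] J(2)] K_pos[OF J(1)] by linarith
  qed (rule symplectic)
qed

section \<open>The function class of the averaging procedure\<close>

text \<open>Functions of the action, the slow time, the angle and \<open>\<epsilon>\<close>, in this order.\<close>

type_synonym symbol = "real \<Rightarrow> real \<Rightarrow> real \<Rightarrow> real \<Rightarrow> real"

locale moving_wall =
  fixes d :: "real \<Rightarrow> real" and c :: real
  assumes smooth: "smooth_on UNIV d" and c_pos: "c > 0" and d_ge: "\<And>\<tau>. d \<tau> \<ge> c"
begin

lemma d_pos: "d \<tau> > 0"
  using c_pos d_ge[of \<tau>] by linarith

text \<open>The algebra generated by \<open>J\<close>, \<open>1/J\<close>, \<open>1/d\<close> and all derivatives of \<open>d\<close> with respect to the slow time.
It is closed under \<open>\<partial>/\<partial>J\<close> and \<open>\<partial>/\<partial>\<tau>\<close>, which makes its members smooth. Its members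
are bounded for admissible times and actions in a compact subset of \<open>(0, \<infinity>)\<close>: admissibility of a set
of times provides a bound on each derivative of \<open>d\<close> there, and \<open>1/d \<le> 1/c\<close>.\<close>

inductive coefficient :: "(real \<Rightarrow> real \<Rightarrow> real) \<Rightarrow> bool" where
  const: "coefficient (\<lambda>J \<tau>. k)"
| action: "coefficient (\<lambda>J \<tau>. J)"
| inverse_action: "coefficient (\<lambda>J \<tau>. inverse J)"
| wall: "coefficient (\<lambda>J \<tau>. (deriv ^^ n) d \<tau>)"
| inverse_wall: "coefficient (\<lambda>J \<tau>. inverse (d \<tau>))"
| add: "coefficient a \<Longrightarrow> coefficient b \<Longrightarrow> coefficient (\<lambda>J \<tau>. a J \<tau> + b J \<tau>)"
| mult: "coefficient a \<Longrightarrow> coefficient b \<Longrightarrow> coefficient (\<lambda>J \<tau>. a J \<tau> * b J \<tau>)"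

lemma coefficient_wall: "coefficient (\<lambda>J \<tau>. d \<tau>)" "coefficient (\<lambda>J \<tau>. deriv d \<tau>)"
  using wall[of 0] wall[of 1] by simp_all

lemma coefficient_cmult: "coefficient a \<Longrightarrow> coefficient (\<lambda>J \<tau>. k * a J \<tau>)"
  by (rule mult[OF const])

lemma coefficient_derivative:
  assumes "coefficient a"
  obtains aJ a\<tau> where "coefficient aJ" "coefficient a\<tau>"
    "\<And>J \<tau>. J > 0 \<Longrightarrow> has_gradient a (aJ J \<tau>) (a\<tau> J \<tau>) J \<tau>"
proof -
  have "\<exists>aJ a\<tau>. coefficient aJ \<and> coefficient a\<tau> \<and> (\<forall>J \<tau>. J > 0 \<longrightarrow>
      ((\<lambda>p. a (fst p) (snd p)) has_derivative (\<lambda>w. fst w * aJ J \<tau> + snd w * a\<tau> J \<tau>)) (at (J, \<tau>)))"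
    using assms
  proof induction
    case (const k)
    show ?case
      by (rule exI[of _ "\<lambda>J \<tau>. 0"], rule exI[of _ "\<lambda>J \<tau>. 0"])
        (auto intro!: coefficient.intros derivative_eq_intros)
  next
    case action
    show ?case
      by (rule exI[of _ "\<lambda>J \<tau>. 1"], rule exI[of _ "\<lambda>J \<tau>. 0"])
        (auto intro!: coefficient.intros derivative_eq_intros)
  next
    case inverse_action
    have "coefficient (\<lambda>J \<tau>. (-1) * (inverse J * inverse J))"
      by (intro coefficient.intros)
    then show ?case
      by (intro exI[of _ "\<lambda>J \<tau>. (-1) * (inverse J * inverse J)"] exI[of _ "\<lambda>J \<tau>. 0"])
        (auto intro!: coefficient.const derivative_eq_intros)
  next
    case (wall n)
    have "((\<lambda>p. (deriv ^^ n) d (snd p)) has_derivative (\<lambda>w. (deriv ^^ Suc n) d \<tau> * snd w)) (at (J, \<tau>))"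
      for J \<tau> :: real
      by (rule has_derivative_compose[of snd snd, where g = "\<lambda>x. (deriv ^^ n) d x" and g' = "\<lambda>y. (deriv ^^ Suc n) d \<tau> * y"])
       (use smooth_on_UNIV_has_iterated_deriv[OF smooth, of n \<tau>] in
         \<open>auto intro!: derivative_eq_intros simp del: funpow.simps simp: has_field_derivative_def\<close>)
    then show ?case
      by (intro exI[of _ "\<lambda>J \<tau>. 0"] exI[of _ "\<lambda>J \<tau>. (deriv ^^ Suc n) d \<tau>"])
        (auto intro: coefficient.intros simp: mult.commute simp del: funpow.simps)
  next
    case inverse_wall
    have "((\<lambda>x. inverse (d x)) has_derivative (\<lambda>y. (-1) * (deriv d \<tau> * (inverse (d \<tau>) * inverse (d \<tau>))) * y)) (at \<tau>)"
      for \<tau>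
      using smooth_on_UNIV_has_iterated_deriv[OF smooth, of 0 \<tau>] d_pos[of \<tau>]
      unfolding has_field_derivative_def
      by (auto intro!: derivative_eq_intros )
    then have "((\<lambda>p. inverse (d (snd p))) has_derivative
        (\<lambda>w. (-1) * (deriv d \<tau> * (inverse (d \<tau>) * inverse (d \<tau>))) * snd w)) (at (J, \<tau>))" for J \<tau> :: real
      by (intro has_derivative_compose[of snd snd, where g = "\<lambda>x. inverse (d x)"])
        (auto intro!: derivative_eq_intros)
    moreover have "coefficient (\<lambda>J \<tau>. (-1) * (deriv d \<tau> * (inverse (d \<tau>) * inverse (d \<tau>))))"
      by (intro coefficient.intros coefficient_wall)
    ultimately show ?case
      by (intro exI[of _ "\<lambda>J \<tau>. 0"] exI[of _ "\<lambda>J \<tau>. (-1) * (deriv d \<tau> * (inverse (d \<tau>) * inverse (d \<tau>)))"])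
        (auto intro: coefficient.intros simp: mult_ac)
  next
    case (add a b)
    then obtain aJ a\<tau> bJ b\<tau> where ab: "coefficient aJ" "coefficient a\<tau>" "coefficient bJ" "coefficient b\<tau>"
      "\<And>J \<tau>. J > 0 \<Longrightarrow> ((\<lambda>p. a (fst p) (snd p)) has_derivative (\<lambda>w. fst w * aJ J \<tau> + snd w * a\<tau> J \<tau>)) (at (J, \<tau>))"
      "\<And>J \<tau>. J > 0 \<Longrightarrow> ((\<lambda>p. b (fst p) (snd p)) has_derivative (\<lambda>w. fst w * bJ J \<tau> + snd w * b\<tau> J \<tau>)) (at (J, \<tau>))"
      by blast
    show ?case
    proof (intro exI conjI allI impI)
      fix J \<tau> :: real assume J: "J > 0"
      show "((\<lambda>p. a (fst p) (snd p) + b (fst p) (snd p)) has_derivative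
          (\<lambda>w. fst w * (aJ J \<tau> + bJ J \<tau>) + snd w * (a\<tau> J \<tau> + b\<tau> J \<tau>))) (at (J, \<tau>))"
        using has_derivative_add[OF ab(5)[OF J] ab(6)[OF J]] by (simp add: algebra_simps)
    qed (intro coefficient.intros ab)+
  next
    case (mult a b)
    then obtain aJ a\<tau> bJ b\<tau> where ab: "coefficient aJ" "coefficient a\<tau>" "coefficient bJ" "coefficient b\<tau>"
      "\<And>J \<tau>. J > 0 \<Longrightarrow> ((\<lambda>p. a (fst p) (snd p)) has_derivative (\<lambda>w. fst w * aJ J \<tau> + snd w * a\<tau> J \<tau>)) (at (J, \<tau>))"
      "\<And>J \<tau>. J > 0 \<Longrightarrow> ((\<lambda>p. b (fst p) (snd p)) has_derivative (\<lambda>w. fst w * bJ J \<tau> + snd w * b\<tau> J \<tau>)) (at (J, \<tau>))"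
      by blast
    show ?case
    proof (intro exI conjI allI impI)
      fix J \<tau> :: real assume J: "J > 0"
      show "((\<lambda>p. a (fst p) (snd p) * b (fst p) (snd p)) has_derivative
          (\<lambda>w. fst w * (aJ J \<tau> * b J \<tau> + a J \<tau> * bJ J \<tau>) + snd w * (a\<tau> J \<tau> * b J \<tau> + a J \<tau> * b\<tau> J \<tau>))) (at (J, \<tau>))"
        using has_derivative_mult[OF ab(5)[OF J] ab(6)[OF J]] by (simp add: algebra_simps)
    qed (intro coefficient.intros ab mult.hyps)+
  qed
  then show ?thesis
    using that by (auto simp: has_gradient_def case_prod_unfold)
qed

lemma coefficient_smooth:
  assumes "coefficient a"
  shows "smooth_on ({0<..} \<times> UNIV) (\<lambda>(J, \<tau>). a J \<tau>)"
proof (rule smooth_on_closed_class[where P = "\<lambda>g. \<exists>a. coefficient a \<and> g = (\<lambda>(J, \<tau>). a J \<tau>)"])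
  show "open ({0<..} \<times> UNIV :: (real \<times> real) set)"
    by (intro open_Times) auto
  show "\<exists>b. coefficient b \<and> (\<lambda>(J, \<tau>). a J \<tau>) = (\<lambda>(J, \<tau>). b J \<tau>)"
    using assms by blast
  fix g :: "real \<times> real \<Rightarrow> real"
  assume "\<exists>a. coefficient a \<and> g = (\<lambda>(J, \<tau>). a J \<tau>)"
  then obtain a where a: "coefficient a" "g = (\<lambda>(J, \<tau>). a J \<tau>)" by blast
  obtain aJ a\<tau> where D: "coefficient aJ" "coefficient a\<tau>"
    "\<And>J \<tau>. J > 0 \<Longrightarrow> (g has_derivative (\<lambda>(u, v). u * aJ J \<tau> + v * a\<tau> J \<tau>)) (at (J, \<tau>))"
    using coefficient_derivative[OF a(1)] a(2) unfolding has_gradient_def by blast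
  have "\<exists>g'. (\<exists>a. coefficient a \<and> g' = (\<lambda>(J, \<tau>). a J \<tau>)) \<and>
      (\<forall>x\<in>{0<..} \<times> UNIV. frechet_derivative g (at x) w = g' x)" for w
  proof (intro exI conjI ballI)
    show "coefficient (\<lambda>J \<tau>. fst w * aJ J \<tau> + snd w * a\<tau> J \<tau>)"
      by (intro coefficient.intros D)
    fix x :: "real \<times> real" assume "x \<in> {0<..} \<times> UNIV"
    then show "frechet_derivative g (at x) w =
        (\<lambda>(J, \<tau>). fst w * aJ J \<tau> + snd w * a\<tau> J \<tau>) x"
      using fun_cong[OF frechet_derivative_at[OF D(3)[of "fst x" "snd x"]], of w]
      by (simp add: case_prod_unfold mem_Times_iff)
  qed simp
  moreover have "g differentiable (at x)" if "x \<in> {0<..} \<times> UNIV" for x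
    using D(3)[of "fst x" "snd x"] that by (auto simp: differentiable_def)
  ultimately show "(\<forall>x\<in>{0<..} \<times> UNIV. g differentiable (at x)) \<and>
      (\<forall>w. \<exists>g'. (\<exists>a. coefficient a \<and> g' = (\<lambda>(J, \<tau>). a J \<tau>)) \<and>
        (\<forall>x\<in>{0<..} \<times> UNIV. frechet_derivative g (at x) w = g' x))"
    by blast
qed

lemma coefficient_bounded:
  assumes "coefficient a" "0 < l" "admissible_times d T"
  obtains B where "\<And>J \<tau>. l \<le> J \<Longrightarrow> J \<le> u \<Longrightarrow> \<tau> \<in> T \<Longrightarrow> \<bar>a J \<tau>\<bar> \<le> B"
proof -
  have "\<exists>B. \<forall>J \<tau>. l \<le> J \<longrightarrow> J \<le> u \<longrightarrow> \<tau> \<in> T \<longrightarrow> \<bar>a J \<tau>\<bar> \<le> B"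
    using assms(1)
  proof induction
    case (const k)
    then show ?case by auto
  next
    case action
    show ?case using \<open>0 < l\<close> by (intro exI[of _ u]) auto
  next
    case inverse_action
    show ?case using \<open>0 < l\<close> by (intro exI[of _ "inverse l"]) auto
  next
    case (wall n)
    have "bounded ((deriv ^^ n) d ` T)"
      using assms(3) unfolding admissible_times_def
    proof
      assume "bounded T"
      then have "compact (closure T)" by (simp add: compact_closure)
      moreover have "continuous_on (closure T) ((deriv ^^ n) d)"
        using smooth_on_UNIV_has_iterated_deriv[OF smooth] by (blast intro: DERIV_continuous_on has_field_derivative_at_within)
      ultimately have "bounded ((deriv ^^ n) d ` closure T)"
        using compact_continuous_image compact_imp_bounded by blast
      then show ?thesis
        by (rule bounded_subset) (use closure_subset in blast)
    next
      assume "\<forall>n. bounded (range ((deriv ^^ n) d))"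
      then show ?thesis by (meson bounded_subset image_mono subset_UNIV)
    qed
    then show ?case by (auto simp: bounded_iff)
  next
    case inverse_wall
    show ?case
    proof (intro exI allI impI)
      fix \<tau> show "\<bar>inverse (d \<tau>)\<bar> \<le> inverse c"
        using c_pos d_ge[of \<tau>] d_pos[of \<tau>] by auto
    qed
  next
    case (add a b)
    then obtain A B where "\<forall>J \<tau>. l \<le> J \<longrightarrow> J \<le> u \<longrightarrow> \<tau> \<in> T \<longrightarrow> \<bar>a J \<tau>\<bar> \<le> A"
      "\<forall>J \<tau>. l \<le> J \<longrightarrow> J \<le> u \<longrightarrow> \<tau> \<in> T \<longrightarrow> \<bar>b J \<tau>\<bar> \<le> B" by blast
    then show ?case
      by (intro exI[of _ "A + B"] allI impI) (meson abs_triangle_ineq add_mono order_trans)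
  next
    case (mult a b)
    then obtain A B where AB: "\<forall>J \<tau>. l \<le> J \<longrightarrow> J \<le> u \<longrightarrow> \<tau> \<in> T \<longrightarrow> \<bar>a J \<tau>\<bar> \<le> A"
      "\<forall>J \<tau>. l \<le> J \<longrightarrow> J \<le> u \<longrightarrow> \<tau> \<in> T \<longrightarrow> \<bar>b J \<tau>\<bar> \<le> B" by blast
    show ?case
    proof (intro exI[of _ "A * B"] allI impI)
      fix J \<tau> assume J: "l \<le> J" "J \<le> u" "\<tau> \<in> T"
      then have "\<bar>a J \<tau>\<bar> \<le> A" "\<bar>b J \<tau>\<bar> \<le> B" using AB by auto
      then show "\<bar>a J \<tau> * b J \<tau>\<bar> \<le> A * B" by (simp add: abs_mult mult_mono)
    qed
  qed
  then show ?thesis using that by blast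
qed

text \<open>Polynomials in the angle \<open>x\<close> and in \<open>\<epsilon>\<close>, with coefficients from the class above. All terms of the
averaging procedure have this form because the sawtooth is the identity on \<open>(-\<pi>, \<pi>)\<close>. Polynomials
are used, rather than arbitrary smooth functions, because integration in \<open>x\<close> and removal of a factor
\<open>\<epsilon>\<close> then stay inside the class and all bounds are inherited from the coefficients.\<close>

inductive angle_poly :: "symbol \<Rightarrow> bool" where
  monomial: "coefficient a \<Longrightarrow> angle_poly (\<lambda>J \<tau> x \<epsilon>. a J \<tau> * x ^ m * \<epsilon> ^ n)"
| plus: "angle_poly g \<Longrightarrow> angle_poly h \<Longrightarrow> angle_poly (\<lambda>J \<tau> x \<epsilon>. g J \<tau> x \<epsilon> + h J \<tau> x \<epsilon>)"

lemma angle_poly_coefficient: "coefficient a \<Longrightarrow> angle_poly (\<lambda>J \<tau> x \<epsilon>. a J \<tau>)"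
  using monomial[of a 0 0] by simp

lemma angle_poly_angle: "angle_poly (\<lambda>J \<tau> x \<epsilon>. x)"
  using monomial[OF const[of 1], of 1 0] by simp

lemma angle_poly_eps_power: "angle_poly (\<lambda>J \<tau> x \<epsilon>. \<epsilon> ^ n)"
  using monomial[OF const[of 1], of 0 n] by simp

lemma angle_poly_times:
  assumes "angle_poly g" "angle_poly h"
  shows "angle_poly (\<lambda>J \<tau> x \<epsilon>. g J \<tau> x \<epsilon> * h J \<tau> x \<epsilon>)"
  using assms(1)
proof induction
  case (monomial a m n)
  note a = monomial
  show ?case using assms(2)
  proof induction
    case (monomial b m' n')
    show ?case
      using angle_poly.monomial[OF coefficient.mult[OF a monomial], of "m + m'" "n + n'"]
      by (simp add: power_add mult_ac)
  next
    case (plus g h)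
    then show ?case using angle_poly.plus[OF plus.IH] by (simp add: distrib_left)
  qed
next
  case (plus g g')
  then show ?case using angle_poly.plus[OF plus.IH] by (simp add: distrib_right)
qed

lemma coefficient_angle_poly:
  assumes "angle_poly g"
  shows "coefficient (\<lambda>J \<tau>. g J \<tau> x \<epsilon>)"
  using assms
proof induction
  case (monomial a m n)
  then show ?case by (intro mult const)
qed (rule add)

lemma angle_poly_eps_split:
  assumes "angle_poly g"
  obtains g0 g1 where "angle_poly (\<lambda>J \<tau> x \<epsilon>. g0 J \<tau> x)" "angle_poly g1"
    "\<And>J \<tau> x \<epsilon>. g J \<tau> x \<epsilon> = g0 J \<tau> x + \<epsilon> * g1 J \<tau> x \<epsilon>"
proof -
  have "\<exists>g0 g1. angle_poly (\<lambda>J \<tau> x \<epsilon>. g0 J \<tau> x) \<and> angle_poly g1 \<and>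
      (\<forall>J \<tau> x \<epsilon>. g J \<tau> x \<epsilon> = g0 J \<tau> x + \<epsilon> * g1 J \<tau> x \<epsilon>)"
    using assms
  proof induction
    case (monomial a m n)
    note zero = angle_poly_coefficient[OF const[of 0]]
    show ?case
    proof (cases n)
      case 0
      show ?thesis
        using angle_poly.monomial[OF monomial, of m 0] zero 0
        by (intro exI[of _ "\<lambda>J \<tau> x. a J \<tau> * x ^ m"] exI[of _ "\<lambda>J \<tau> x \<epsilon>. 0"]) simp
    next
      case (Suc k)
      show ?thesis
        using angle_poly.monomial[OF monomial, of m k] zero Suc
        by (intro exI[of _ "\<lambda>J \<tau> x. 0"] exI[of _ "\<lambda>J \<tau> x \<epsilon>. a J \<tau> * x ^ m * \<epsilon> ^ k"]) simp
    qed
  next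
    case (plus g h)
    then obtain g0 g1 h0 h1 where
      gh: "angle_poly (\<lambda>J \<tau> x \<epsilon>. g0 J \<tau> x)" "angle_poly g1"
        "angle_poly (\<lambda>J \<tau> x \<epsilon>. h0 J \<tau> x)" "angle_poly h1"
      "\<And>J \<tau> x \<epsilon>. g J \<tau> x \<epsilon> = g0 J \<tau> x + \<epsilon> * g1 J \<tau> x \<epsilon>"
      "\<And>J \<tau> x \<epsilon>. h J \<tau> x \<epsilon> = h0 J \<tau> x + \<epsilon> * h1 J \<tau> x \<epsilon>"
      by blast
    show ?case
      by (intro exI[of _ "\<lambda>J \<tau> x. g0 J \<tau> x + h0 J \<tau> x"] exI[of _ "\<lambda>J \<tau> x \<epsilon>. g1 J \<tau> x \<epsilon> + h1 J \<tau> x \<epsilon>"] conjI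
        angle_poly.plus gh) (simp add: gh algebra_simps)
  qed
  then show ?thesis using that by blast
qed

lemma angle_poly_antiderivative:
  assumes "angle_poly (\<lambda>J \<tau> x \<epsilon>. g J \<tau> x)"
  obtains G where "angle_poly (\<lambda>J \<tau> x \<epsilon>. G J \<tau> x)"
    "\<And>J \<tau> x. ((\<lambda>y. G J \<tau> y) has_real_derivative g J \<tau> x) (at x)"
proof -
  have *: "\<exists>G. angle_poly G \<and>
      (\<forall>J \<tau> x \<epsilon>. ((\<lambda>y. G J \<tau> y \<epsilon>) has_real_derivative g J \<tau> x \<epsilon>) (at x))"
    if "angle_poly g" for g
    using that
  proof induction
    case (monomial a m n)
    have "angle_poly (\<lambda>J \<tau> x \<epsilon>. (1 / Suc m * a J \<tau>) * x ^ Suc m * \<epsilon> ^ n)"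
      by (intro angle_poly.monomial mult const monomial)
    moreover have "((\<lambda>y. (1 / Suc m * a J \<tau>) * y ^ Suc m * \<epsilon> ^ n) has_real_derivative
        a J \<tau> * x ^ m * \<epsilon> ^ n) (at x)" for J \<tau> x \<epsilon>
    proof -
      have "((\<lambda>y. (1 / Suc m * a J \<tau>) * y ^ Suc m * \<epsilon> ^ n) has_real_derivative
        (1 / Suc m * a J \<tau>) * (Suc m * x ^ m) * \<epsilon> ^ n) (at x)"
        by (intro DERIV_cmult_right DERIV_cmult) (use DERIV_pow[of "Suc m" x] in simp)
      moreover have "(1 / Suc m * a J \<tau>) * (Suc m * x ^ m) = a J \<tau> * x ^ m"
        by (simp add: field_simps del: of_nat_Suc)
      ultimately show ?thesis by simp
    qed
    ultimately show ?case by blast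
  next
    case (plus g h)
    then obtain G H where "angle_poly G" "angle_poly H"
      "\<And>J \<tau> x \<epsilon>. ((\<lambda>y. G J \<tau> y \<epsilon>) has_real_derivative g J \<tau> x \<epsilon>) (at x)"
      "\<And>J \<tau> x \<epsilon>. ((\<lambda>y. H J \<tau> y \<epsilon>) has_real_derivative h J \<tau> x \<epsilon>) (at x)"
      by blast
    then show ?case
      by (intro exI[of _ "\<lambda>J \<tau> x \<epsilon>. G J \<tau> x \<epsilon> + H J \<tau> x \<epsilon>"]) (auto intro: angle_poly.plus DERIV_add)
  qed
  \<comment> \<open>The antiderivative obtained above may depend on \<open>\<epsilon>\<close> formally; it is evaluated at \<open>\<epsilon> = 0\<close>.\<close>
  have eval: "angle_poly (\<lambda>J \<tau> x \<epsilon>. G J \<tau> x 0)" if "angle_poly G" for G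
    using that
  proof induction
    case (monomial a m n)
    show ?case
      using angle_poly.monomial[OF mult[OF monomial const[of "0 ^ n"]], of m 0] by (simp add: mult_ac)
  qed (rule angle_poly.plus)
  obtain G where "angle_poly G"
    "\<And>J \<tau> x \<epsilon>. ((\<lambda>y. G J \<tau> y \<epsilon>) has_real_derivative g J \<tau> x) (at x)"
    using *[OF assms] by blast
  then show ?thesis using that[of "\<lambda>J \<tau> x. G J \<tau> x 0"] eval by blast
qed

lemma angle_poly_bounded:
  assumes "angle_poly g" "0 < l" "admissible_times d T"
  obtains B where "\<And>J \<tau> x \<epsilon>. \<lbrakk>l \<le> J; J \<le> u; \<tau> \<in> T; -pi \<le> x; x \<le> pi; 0 \<le> \<epsilon>; \<epsilon> \<le> 1\<rbrakk> \<Longrightarrow> \<bar>g J \<tau> x \<epsilon>\<bar> \<le> B"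
proof -
  have "\<exists>B. \<forall>J \<tau> x \<epsilon>. l \<le> J \<longrightarrow> J \<le> u \<longrightarrow> \<tau> \<in> T \<longrightarrow> -pi \<le> x \<longrightarrow> x \<le> pi \<longrightarrow> 0 \<le> \<epsilon> \<longrightarrow> \<epsilon> \<le> 1 \<longrightarrow>
      \<bar>g J \<tau> x \<epsilon>\<bar> \<le> B"
    using assms(1)
  proof induction
    case (monomial a m n)
    obtain B where B: "\<And>J \<tau>. l \<le> J \<Longrightarrow> J \<le> u \<Longrightarrow> \<tau> \<in> T \<Longrightarrow> \<bar>a J \<tau>\<bar> \<le> B"
      using coefficient_bounded[OF monomial assms(2,3)] by blast
    show ?case
    proof (intro exI allI impI)
      fix J \<tau> x \<epsilon> :: real
      assume *: "l \<le> J" "J \<le> u" "\<tau> \<in> T" "-pi \<le> x" "x \<le> pi" "0 \<le> \<epsilon>" "\<epsilon> \<le> 1"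
      have "\<bar>x\<bar> ^ m \<le> pi ^ m" using * by (intro power_mono) auto
      moreover have "\<bar>\<epsilon>\<bar> ^ n \<le> 1" using * by (auto simp: power_le_one)
      ultimately show "\<bar>a J \<tau> * x ^ m * \<epsilon> ^ n\<bar> \<le> B * pi ^ m * 1"
        using B[OF *(1-3)] unfolding abs_mult power_abs by (intro mult_mono) auto
    qed
  next
    case (plus g h)
    then obtain A B where
      "\<forall>J \<tau> x \<epsilon>. l \<le> J \<longrightarrow> J \<le> u \<longrightarrow> \<tau> \<in> T \<longrightarrow> -pi \<le> x \<longrightarrow> x \<le> pi \<longrightarrow> 0 \<le> \<epsilon> \<longrightarrow> \<epsilon> \<le> 1 \<longrightarrow> \<bar>g J \<tau> x \<epsilon>\<bar> \<le> A"
      "\<forall>J \<tau> x \<epsilon>. l \<le> J \<longrightarrow> J \<le> u \<longrightarrow> \<tau> \<in> T \<longrightarrow> -pi \<le> x \<longrightarrow> x \<le> pi \<longrightarrow> 0 \<le> \<epsilon> \<longrightarrow> \<epsilon> \<le> 1 \<longrightarrow> \<bar>h J \<tau> x \<epsilon>\<bar> \<le> B"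
      by blast
    then show ?case
      by (intro exI[of _ "A + B"] allI impI) (meson abs_triangle_ineq add_mono order_trans)
  qed
  then show ?thesis using that by blast
qed

lemma continuous_on_angle_poly:
  assumes "angle_poly g"
  shows "continuous_on A (\<lambda>x. g J \<tau> x \<epsilon>)"
  using assms
proof induction
  case (monomial a m n)
  show ?case by (intro continuous_on_mult continuous_on_power continuous_on_const continuous_on_id)
qed (rule continuous_on_add)

lemma angle_poly_sum:
  assumes "finite A" "\<And>i. i \<in> A \<Longrightarrow> angle_poly (f i)"
  shows "angle_poly (\<lambda>J \<tau> x \<epsilon>. \<Sum>i\<in>A. f i J \<tau> x \<epsilon>)"
  using assms
proof (induction A rule: finite_induct)
  case empty
  show ?case using angle_poly_coefficient[OF const[of 0]] by simp
next
  case (insert i A)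
  have "angle_poly (\<lambda>J \<tau> x \<epsilon>. f i J \<tau> x \<epsilon> + (\<Sum>i\<in>A. f i J \<tau> x \<epsilon>))"
    using insert by (intro angle_poly.plus) auto
  then show ?case using insert.hyps by simp
qed

text \<open>The derivatives of a symbol that enter the change of variables. Both mixed derivatives are the same
function \<open>gJx\<close>; this equality is what makes the Jacobian equal to 1.\<close>

definition second_jet ::
  "symbol \<Rightarrow> symbol \<Rightarrow> symbol \<Rightarrow> symbol \<Rightarrow> symbol \<Rightarrow> symbol \<Rightarrow> symbol \<Rightarrow> bool" where
  "second_jet g g\<tau> gJ gx gJJ gJx gxx \<longleftrightarrow>
    angle_poly g\<tau> \<and> angle_poly gJ \<and> angle_poly gx \<and>
    angle_poly gJJ \<and> angle_poly gJx \<and> angle_poly gxx \<and>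
    (\<forall>J \<tau> x \<epsilon>. J > 0 \<longrightarrow> ((\<lambda>t. g J t x \<epsilon>) has_real_derivative g\<tau> J \<tau> x \<epsilon>) (at \<tau>) \<and>
      has_gradient (\<lambda>J x. g J \<tau> x \<epsilon>) (gJ J \<tau> x \<epsilon>) (gx J \<tau> x \<epsilon>) J x \<and>
      has_gradient (\<lambda>J x. gJ J \<tau> x \<epsilon>) (gJJ J \<tau> x \<epsilon>) (gJx J \<tau> x \<epsilon>) J x \<and>
      has_gradient (\<lambda>J x. gx J \<tau> x \<epsilon>) (gJx J \<tau> x \<epsilon>) (gxx J \<tau> x \<epsilon>) J x)"

lemma second_jetD:
  assumes "second_jet g g\<tau> gJ gx gJJ gJx gxx"
  shows "angle_poly g\<tau>" "angle_poly gJ" "angle_poly gx" "angle_poly gJJ" "angle_poly gJx" "angle_poly gxx"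
    "J > 0 \<Longrightarrow> ((\<lambda>t. g J t x \<epsilon>) has_real_derivative g\<tau> J \<tau> x \<epsilon>) (at \<tau>)"
    "J > 0 \<Longrightarrow> has_gradient (\<lambda>J x. g J \<tau> x \<epsilon>) (gJ J \<tau> x \<epsilon>) (gx J \<tau> x \<epsilon>) J x"
    "J > 0 \<Longrightarrow> has_gradient (\<lambda>J x. gJ J \<tau> x \<epsilon>) (gJJ J \<tau> x \<epsilon>) (gJx J \<tau> x \<epsilon>) J x"
    "J > 0 \<Longrightarrow> has_gradient (\<lambda>J x. gx J \<tau> x \<epsilon>) (gJx J \<tau> x \<epsilon>) (gxx J \<tau> x \<epsilon>) J x"
  using assms unfolding second_jet_def by blast+

lemma angle_poly_second_jet:
  assumes "angle_poly g"
  shows "\<exists>g\<tau> gJ gx gJJ gJx gxx. second_jet g g\<tau> gJ gx gJJ gJx gxx"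
  using assms
proof induction
  case (monomial a m n)
    obtain aJ a\<tau> where a: "coefficient aJ" "coefficient a\<tau>"
      "\<And>J \<tau>. J > 0 \<Longrightarrow> has_gradient a (aJ J \<tau>) (a\<tau> J \<tau>) J \<tau>"
      by (rule coefficient_derivative[OF monomial]) blast
    obtain aJJ aJ\<tau> where aJ: "coefficient aJJ"
      "\<And>J \<tau>. J > 0 \<Longrightarrow> has_gradient aJ (aJJ J \<tau>) (aJ\<tau> J \<tau>) J \<tau>"
      by (rule coefficient_derivative[OF a(1)]) blast
    show ?case
    unfolding second_jet_def
    proof (intro exI conjI allI impI)
      show "angle_poly (\<lambda>J \<tau> x \<epsilon>. a\<tau> J \<tau> * x ^ m * \<epsilon> ^ n)"
        "angle_poly (\<lambda>J \<tau> x \<epsilon>. aJ J \<tau> * x ^ m * \<epsilon> ^ n)"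
        "angle_poly (\<lambda>J \<tau> x \<epsilon>. (real m * a J \<tau>) * x ^ (m - 1) * \<epsilon> ^ n)"
        "angle_poly (\<lambda>J \<tau> x \<epsilon>. aJJ J \<tau> * x ^ m * \<epsilon> ^ n)"
        "angle_poly (\<lambda>J \<tau> x \<epsilon>. (real m * aJ J \<tau>) * x ^ (m - 1) * \<epsilon> ^ n)"
        "angle_poly (\<lambda>J \<tau> x \<epsilon>. (real (m - 1) * (real m * a J \<tau>)) * x ^ (m - 1 - 1) * \<epsilon> ^ n)"
        by (intro angle_poly.monomial coefficient_cmult a aJ monomial)+
      fix J \<tau> x \<epsilon> :: real assume J: "J > 0"
      show "((\<lambda>t. a J t * x ^ m * \<epsilon> ^ n) has_real_derivative a\<tau> J \<tau> * x ^ m * \<epsilon> ^ n) (at \<tau>)"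
        by (intro DERIV_cmult_right has_gradient_partials(2)[OF a(3)[OF J]])
      show "has_gradient (\<lambda>J x. a J \<tau> * x ^ m * \<epsilon> ^ n) (aJ J \<tau> * x ^ m * \<epsilon> ^ n)
          (real m * a J \<tau> * x ^ (m - 1) * \<epsilon> ^ n) J x"
        by (intro has_gradient_monomial has_gradient_partials(1)[OF a(3)[OF J]])
      show "has_gradient (\<lambda>J x. aJ J \<tau> * x ^ m * \<epsilon> ^ n) (aJJ J \<tau> * x ^ m * \<epsilon> ^ n)
          (real m * aJ J \<tau> * x ^ (m - 1) * \<epsilon> ^ n) J x"
        by (intro has_gradient_monomial has_gradient_partials(1)[OF aJ(2)[OF J]])
      show "has_gradient (\<lambda>J x. real m * a J \<tau> * x ^ (m - 1) * \<epsilon> ^ n)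
          (real m * aJ J \<tau> * x ^ (m - 1) * \<epsilon> ^ n)
          (real (m - 1) * (real m * a J \<tau>) * x ^ (m - 1 - 1) * \<epsilon> ^ n) J x"
        by (intro has_gradient_monomial DERIV_cmult has_gradient_partials(1)[OF a(3)[OF J]])
    qed
  next
    case (plus g h)
    from plus.IH(1) obtain g\<tau> gJ gx gJJ gJx gxx where g: "second_jet g g\<tau> gJ gx gJJ gJx gxx"
      by blast
    from plus.IH(2) obtain h\<tau> hJ hx hJJ hJx hxx where h: "second_jet h h\<tau> hJ hx hJJ hJx hxx"
      by blast
    show ?case
    unfolding second_jet_def
    proof (intro exI conjI allI impI)
      show "angle_poly (\<lambda>J \<tau> x \<epsilon>. g\<tau> J \<tau> x \<epsilon> + h\<tau> J \<tau> x \<epsilon>)"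
        by (intro angle_poly.plus second_jetD[OF g] second_jetD[OF h])
      show "angle_poly (\<lambda>J \<tau> x \<epsilon>. gJ J \<tau> x \<epsilon> + hJ J \<tau> x \<epsilon>)"
        by (intro angle_poly.plus second_jetD[OF g] second_jetD[OF h])
      show "angle_poly (\<lambda>J \<tau> x \<epsilon>. gx J \<tau> x \<epsilon> + hx J \<tau> x \<epsilon>)"
        by (intro angle_poly.plus second_jetD[OF g] second_jetD[OF h])
      show "angle_poly (\<lambda>J \<tau> x \<epsilon>. gJJ J \<tau> x \<epsilon> + hJJ J \<tau> x \<epsilon>)"
        by (intro angle_poly.plus second_jetD[OF g] second_jetD[OF h])
      show "angle_poly (\<lambda>J \<tau> x \<epsilon>. gJx J \<tau> x \<epsilon> + hJx J \<tau> x \<epsilon>)"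
        by (intro angle_poly.plus second_jetD[OF g] second_jetD[OF h])
      show "angle_poly (\<lambda>J \<tau> x \<epsilon>. gxx J \<tau> x \<epsilon> + hxx J \<tau> x \<epsilon>)"
        by (intro angle_poly.plus second_jetD[OF g] second_jetD[OF h])
      fix J \<tau> x \<epsilon> :: real assume J: "J > 0"
      show "((\<lambda>t. g J t x \<epsilon> + h J t x \<epsilon>) has_real_derivative g\<tau> J \<tau> x \<epsilon> + h\<tau> J \<tau> x \<epsilon>) (at \<tau>)"
        by (intro DERIV_add second_jetD(7)[OF g] second_jetD(7)[OF h] J)
      show "has_gradient (\<lambda>J x. g J \<tau> x \<epsilon> + h J \<tau> x \<epsilon>) (gJ J \<tau> x \<epsilon> + hJ J \<tau> x \<epsilon>) (gx J \<tau> x \<epsilon> + hx J \<tau> x \<epsilon>) J x"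
        by (intro has_gradient_add second_jetD(8)[OF g] second_jetD(8)[OF h] J)
      show "has_gradient (\<lambda>J x. gJ J \<tau> x \<epsilon> + hJ J \<tau> x \<epsilon>) (gJJ J \<tau> x \<epsilon> + hJJ J \<tau> x \<epsilon>) (gJx J \<tau> x \<epsilon> + hJx J \<tau> x \<epsilon>) J x"
        by (intro has_gradient_add second_jetD(9)[OF g] second_jetD(9)[OF h] J)
      show "has_gradient (\<lambda>J x. gx J \<tau> x \<epsilon> + hx J \<tau> x \<epsilon>) (gJx J \<tau> x \<epsilon> + hJx J \<tau> x \<epsilon>) (gxx J \<tau> x \<epsilon> + hxx J \<tau> x \<epsilon>) J x"
        by (intro has_gradient_add second_jetD(10)[OF g] second_jetD(10)[OF h] J)
    qed
  qed

section \<open>Averaging\<close>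

text \<open>The state of the procedure after \<open>n\<close> steps. With \<open>gx\<close> and \<open>g\<tau>\<close> for the derivatives of the generating
function, the last clause says that the Hamiltonian in the new action is the energy plus the
angle-free terms \<open>\<epsilon>\<^sup>ih\<^sub>i\<close> and a remainder \<open>\<epsilon>\<^sup>n\<^sup>+\<^sup>1\<rho>\<close>. Here \<open>x\<close> takes the place of the sawtooth, and the
identity, being one between polynomials in \<open>x\<close> and \<open>\<epsilon>\<close>, is stated for all values of both.\<close>

definition normal_form ::
  "nat \<Rightarrow> (nat \<Rightarrow> real \<Rightarrow> real \<Rightarrow> real \<Rightarrow> real) \<Rightarrow> (nat \<Rightarrow> real \<Rightarrow> real \<Rightarrow> real) \<Rightarrow>
   symbol \<Rightarrow> symbol \<Rightarrow> symbol \<Rightarrow> bool" where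
  "normal_form n s h gx g\<tau> \<rho> \<longleftrightarrow>
    (\<forall>i\<in>{1..n}. angle_poly (\<lambda>J \<tau> x \<epsilon>. s i J \<tau> x) \<and>
      (\<forall>J \<tau>. s i J \<tau> pi = s i J \<tau> (-pi)) \<and> coefficient (h i)) \<and>
    angle_poly gx \<and> angle_poly g\<tau> \<and> angle_poly \<rho> \<and>
    (\<forall>J \<tau> x \<epsilon>. J > 0 \<longrightarrow>
      ((\<lambda>y. \<Sum>i=1..n. \<epsilon> ^ (i - 1) * s i J \<tau> y) has_real_derivative gx J \<tau> x \<epsilon>) (at x) \<and>
      ((\<lambda>t. \<Sum>i=1..n. \<epsilon> ^ (i - 1) * s i J t x) has_real_derivative g\<tau> J \<tau> x \<epsilon>) (at \<tau>) \<and>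
      energy d (J + \<epsilon> * gx J \<tau> x \<epsilon>) \<tau> - \<epsilon> * ((J + \<epsilon> * gx J \<tau> x \<epsilon>) * deriv d \<tau> / d \<tau>) * x
          + \<epsilon>\<^sup>2 * g\<tau> J \<tau> x \<epsilon> =
        energy d J \<tau> + (\<Sum>i=1..n. \<epsilon> ^ i * h i J \<tau>) + \<epsilon> ^ Suc n * \<rho> J \<tau> x \<epsilon>)"

lemma normal_formD:
  assumes "normal_form n s h gx g\<tau> \<rho>"
  shows "i \<in> {1..n} \<Longrightarrow> angle_poly (\<lambda>J \<tau> x \<epsilon>. s i J \<tau> x)"
    "i \<in> {1..n} \<Longrightarrow> s i J \<tau> pi = s i J \<tau> (-pi)"
    "i \<in> {1..n} \<Longrightarrow> coefficient (h i)"
    "angle_poly gx" "angle_poly g\<tau>" "angle_poly \<rho>"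
    "J > 0 \<Longrightarrow> ((\<lambda>y. \<Sum>i=1..n. \<epsilon> ^ (i - 1) * s i J \<tau> y) has_real_derivative gx J \<tau> x \<epsilon>) (at x)"
    "J > 0 \<Longrightarrow> ((\<lambda>t. \<Sum>i=1..n. \<epsilon> ^ (i - 1) * s i J t x) has_real_derivative g\<tau> J \<tau> x \<epsilon>) (at \<tau>)"
    "J > 0 \<Longrightarrow> energy d (J + \<epsilon> * gx J \<tau> x \<epsilon>) \<tau>
        - \<epsilon> * ((J + \<epsilon> * gx J \<tau> x \<epsilon>) * deriv d \<tau> / d \<tau>) * x + \<epsilon>\<^sup>2 * g\<tau> J \<tau> x \<epsilon> =
      energy d J \<tau> + (\<Sum>i=1..n. \<epsilon> ^ i * h i J \<tau>) + \<epsilon> ^ Suc n * \<rho> J \<tau> x \<epsilon>"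
  using assms unfolding normal_form_def by blast+

text \<open>The effect of adding \<open>\<epsilon>\<^sup>n u\<close> to the generating function, as an algebraic identity: \<open>k = \<pi>\<^sup>2/d\<^sup>2\<close>,
\<open>w = d'/d\<close>, \<open>e = \<epsilon>\<^sup>n\<close>, the letters \<open>P, Q\<close> stand for the \<open>x\<close>- and \<open>\<tau>\<close>-derivative of the old generating
function, \<open>p, q\<close> for those of \<open>u\<close>, and \<open>r0 + \<epsilon> r1\<close> is the old remainder. The energy is quadratic
in the action, so the only change of order \<open>\<epsilon> e\<close> is \<open>k J p\<close>, chosen to turn \<open>r0\<close> into its mean \<open>m\<close>.\<close>

lemma energy_shift:
  fixes k w J x e \<epsilon> P p Q q r0 r1 m H :: real
  assumes old: "k * (J + \<epsilon> * P)\<^sup>2 / 2 - \<epsilon> * ((J + \<epsilon> * P) * w) * x + \<epsilon>\<^sup>2 * Q =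
      k * J\<^sup>2 / 2 + H + \<epsilon> * e * (r0 + \<epsilon> * r1)"
    and homological: "k * J * p = m - r0"
  shows "k * (J + \<epsilon> * (P + e * p))\<^sup>2 / 2 - \<epsilon> * ((J + \<epsilon> * (P + e * p)) * w) * x + \<epsilon>\<^sup>2 * (Q + e * q) =
      k * J\<^sup>2 / 2 + (H + \<epsilon> * e * m) +
      \<epsilon> * (\<epsilon> * e) * (r1 + k * P * p + k / 2 * e * p * p + (- 1) * w * p * x + q)"
proof -
  have "k * (J + \<epsilon> * (P + e * p))\<^sup>2 / 2 - \<epsilon> * ((J + \<epsilon> * (P + e * p)) * w) * x + \<epsilon>\<^sup>2 * (Q + e * q) =
      (k * (J + \<epsilon> * P)\<^sup>2 / 2 - \<epsilon> * ((J + \<epsilon> * P) * w) * x + \<epsilon>\<^sup>2 * Q) + \<epsilon> * e * (k * J * p) +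
      \<epsilon> * (\<epsilon> * e) * (k * P * p + k / 2 * e * p * p + (- 1) * w * p * x + q)"
    by (simp add: power2_eq_square field_simps)
  then show ?thesis
    unfolding old homological by (simp add: algebra_simps)
qed

text \<open>The frequency \<open>\<omega> = \<pi>\<^sup>2J/d\<^sup>2\<close> does not vanish, hence \<open>\<omega> s\<^sub>x = m - \<rho>\<close> is solved by integration in \<open>x\<close>. The
solution takes the same value at \<open>\<plusminus>\<pi>\<close> exactly when \<open>m\<close> is the mean of \<open>\<rho>\<close> over \<open>[-\<pi>, \<pi>]\<close>; the
discontinuity of \<open>\<rho>\<close> as a function on the circle only costs differentiability of \<open>s\<close> at the jumps.\<close>

lemma homological_equation:
  assumes "angle_poly (\<lambda>J \<tau> x \<epsilon>. \<rho> J \<tau> x)"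
  obtains s s\<tau> sx m where "coefficient m" "angle_poly (\<lambda>J \<tau> x \<epsilon>. s J \<tau> x)"
    "\<And>J \<tau>. s J \<tau> pi = s J \<tau> (-pi)" "angle_poly s\<tau>" "angle_poly sx"
    "\<And>J \<tau> x \<epsilon>. J > 0 \<Longrightarrow> ((\<lambda>t. s J t x) has_real_derivative s\<tau> J \<tau> x \<epsilon>) (at \<tau>)"
    "\<And>J \<tau> x \<epsilon>. J > 0 \<Longrightarrow> ((\<lambda>y. s J \<tau> y) has_real_derivative sx J \<tau> x \<epsilon>) (at x)"
    "\<And>J \<tau> x \<epsilon>. J > 0 \<Longrightarrow> pi\<^sup>2 / (d \<tau>)\<^sup>2 * J * sx J \<tau> x \<epsilon> = m J \<tau> - \<rho> J \<tau> x"
proof -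
  obtain G where G: "angle_poly (\<lambda>J \<tau> x \<epsilon>. G J \<tau> x)"
    "\<And>J \<tau> x. ((\<lambda>y. G J \<tau> y) has_real_derivative \<rho> J \<tau> x) (at x)"
    using angle_poly_antiderivative[OF assms] by blast
  define m :: "real \<Rightarrow> real \<Rightarrow> real"
    where "m = (\<lambda>J \<tau>. 1 / (2 * pi) * (G J \<tau> pi + (- 1) * G J \<tau> (-pi)))"
  define k :: "real \<Rightarrow> real \<Rightarrow> real"
    where "k = (\<lambda>J \<tau>. 1 / pi\<^sup>2 * (d \<tau> * (d \<tau> * inverse J)))"
  define s :: "real \<Rightarrow> real \<Rightarrow> real \<Rightarrow> real"
    where "s = (\<lambda>J \<tau> x. k J \<tau> * (m J \<tau> * x + (- 1) * G J \<tau> x))"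
  have m: "coefficient m"
    unfolding m_def by (intro coefficient.intros coefficient_angle_poly[OF G(1)])
  have k: "coefficient k"
    unfolding k_def by (intro coefficient.intros coefficient_wall)
  have s: "angle_poly (\<lambda>J \<tau> x \<epsilon>. s J \<tau> x)"
    unfolding s_def
    by (intro angle_poly_times[OF angle_poly_coefficient[OF k]] angle_poly.plus
        angle_poly_times[OF angle_poly_coefficient[OF m] angle_poly_angle]
        angle_poly_times[OF angle_poly_coefficient[OF const] G(1)])
  obtain s\<tau> sJ sx sJJ sJx sxx where jet: "second_jet (\<lambda>J \<tau> x \<epsilon>. s J \<tau> x) s\<tau> sJ sx sJJ sJx sxx"
    using angle_poly_second_jet[OF s] by blast
  have Dx: "((\<lambda>y. s J \<tau> y) has_real_derivative sx J \<tau> x \<epsilon>) (at x)" if "J > 0" for J \<tau> x \<epsilon>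
    using has_gradient_partials(2)[OF second_jetD(8)[OF jet that]] by simp
  show ?thesis
  proof (rule that[OF m s _ second_jetD(1)[OF jet] second_jetD(3)[OF jet] _ Dx])
    show "s J \<tau> pi = s J \<tau> (-pi)" for J \<tau>
      by (simp add: s_def m_def field_simps)
    fix J \<tau> x \<epsilon> :: real assume J: "J > 0"
    show "((\<lambda>t. s J t x) has_real_derivative s\<tau> J \<tau> x \<epsilon>) (at \<tau>)"
      using second_jetD(7)[OF jet J] by simp
    have "((\<lambda>y. s J \<tau> y) has_real_derivative k J \<tau> * (m J \<tau> * 1 + (- 1) * \<rho> J \<tau> x)) (at x)"
      unfolding s_def by (intro DERIV_cmult DERIV_add DERIV_ident G(2))
    then have "sx J \<tau> x \<epsilon> = k J \<tau> * (m J \<tau> - \<rho> J \<tau> x)"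
      using DERIV_unique[OF Dx[OF J]] by fastforce
    then show "pi\<^sup>2 / (d \<tau>)\<^sup>2 * J * sx J \<tau> x \<epsilon> = m J \<tau> - \<rho> J \<tau> x"
      using J d_pos[of \<tau>] by (simp add: k_def power2_eq_square field_simps)
  qed
qed

text \<open>Only the part of the remainder that is free of \<open>\<epsilon>\<close> is averaged; the rest already carries another
factor \<open>\<epsilon>\<close> and joins the next remainder.\<close>

lemma normal_form_step:
  assumes nf: "normal_form n s h gx g\<tau> \<rho>"
  shows "\<exists>s' h' gx' g\<tau>' \<rho>'. normal_form (Suc n) s' h' gx' g\<tau>' \<rho>'"
proof -
  obtain \<rho>0 \<rho>1 where \<rho>: "angle_poly (\<lambda>J \<tau> x \<epsilon>. \<rho>0 J \<tau> x)" "angle_poly \<rho>1"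
    "\<And>J \<tau> x \<epsilon>. \<rho> J \<tau> x \<epsilon> = \<rho>0 J \<tau> x + \<epsilon> * \<rho>1 J \<tau> x \<epsilon>"
    using angle_poly_eps_split[OF normal_formD(6)[OF nf]] by blast
  obtain u u\<tau> ux m where u: "coefficient m" "angle_poly (\<lambda>J \<tau> x \<epsilon>. u J \<tau> x)"
    "\<And>J \<tau>. u J \<tau> pi = u J \<tau> (-pi)" "angle_poly u\<tau>" "angle_poly ux"
    "\<And>J \<tau> x \<epsilon>. J > 0 \<Longrightarrow> ((\<lambda>t. u J t x) has_real_derivative u\<tau> J \<tau> x \<epsilon>) (at \<tau>)"
    "\<And>J \<tau> x \<epsilon>. J > 0 \<Longrightarrow> ((\<lambda>y. u J \<tau> y) has_real_derivative ux J \<tau> x \<epsilon>) (at x)"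
    "\<And>J \<tau> x \<epsilon>. J > 0 \<Longrightarrow> pi\<^sup>2 / (d \<tau>)\<^sup>2 * J * ux J \<tau> x \<epsilon> = m J \<tau> - \<rho>0 J \<tau> x"
    by (rule homological_equation[OF \<rho>(1)]) blast
  define s' where "s' = s(Suc n := u)"
  define h' where "h' = h(Suc n := m)"
  define k :: "real \<Rightarrow> real \<Rightarrow> real" where "k = (\<lambda>J \<tau>. pi\<^sup>2 * (inverse (d \<tau>) * inverse (d \<tau>)))"
  define w :: "real \<Rightarrow> real \<Rightarrow> real" where "w = (\<lambda>J \<tau>. deriv d \<tau> * inverse (d \<tau>))"
  define gx' :: symbol where "gx' = (\<lambda>J \<tau> x \<epsilon>. gx J \<tau> x \<epsilon> + \<epsilon> ^ n * ux J \<tau> x \<epsilon>)"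
  define g\<tau>' :: symbol where "g\<tau>' = (\<lambda>J \<tau> x \<epsilon>. g\<tau> J \<tau> x \<epsilon> + \<epsilon> ^ n * u\<tau> J \<tau> x \<epsilon>)"
  define \<rho>' :: symbol where "\<rho>' = (\<lambda>J \<tau> x \<epsilon>. \<rho>1 J \<tau> x \<epsilon> + k J \<tau> * gx J \<tau> x \<epsilon> * ux J \<tau> x \<epsilon> +
      k J \<tau> / 2 * \<epsilon> ^ n * ux J \<tau> x \<epsilon> * ux J \<tau> x \<epsilon> + (- 1) * w J \<tau> * ux J \<tau> x \<epsilon> * x + u\<tau> J \<tau> x \<epsilon>)"
  have k: "coefficient k" and w: "coefficient w"
    unfolding k_def w_def by (intro coefficient.intros coefficient_wall)+
  have k_half: "angle_poly (\<lambda>J \<tau> x \<epsilon>. k J \<tau> / 2)"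
    using angle_poly_coefficient[OF mult[OF k const[of "1 / 2"]]] by simp
  have minus_one: "angle_poly (\<lambda>J \<tau> x \<epsilon>. - 1)"
    by (rule angle_poly_coefficient[OF const])
  note poly = angle_poly.plus angle_poly_times angle_poly_coefficient[OF k] angle_poly_coefficient[OF w]
    k_half minus_one angle_poly_angle angle_poly_eps_power normal_formD(4,5)[OF nf] u(4,5) \<rho>(2)
  have "normal_form (Suc n) s' h' gx' g\<tau>' \<rho>'"
    unfolding normal_form_def
  proof (intro conjI ballI allI impI)
    fix i assume "i \<in> {1..Suc n}"
    then have "i = Suc n \<or> i \<in> {1..n}" by auto
    then show "angle_poly (\<lambda>J \<tau> x \<epsilon>. s' i J \<tau> x)" "coefficient (h' i)"
      "s' i J \<tau> pi = s' i J \<tau> (-pi)" for J \<tau>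
      using u(1-3) normal_formD(1-3)[OF nf, of i] by (auto simp: s'_def h'_def)
  next
    show "angle_poly gx'" "angle_poly g\<tau>'" "angle_poly \<rho>'"
      unfolding gx'_def g\<tau>'_def \<rho>'_def by (intro poly)+
  next
    fix J \<tau> x \<epsilon> :: real assume J: "J > 0"
    have "((\<lambda>y. (\<Sum>i=1..n. \<epsilon> ^ (i - 1) * s i J \<tau> y) + \<epsilon> ^ n * u J \<tau> y) has_real_derivative gx' J \<tau> x \<epsilon>) (at x)"
      unfolding gx'_def by (intro DERIV_add DERIV_cmult normal_formD(7)[OF nf] u J)
    then show "((\<lambda>y. \<Sum>i=1..Suc n. \<epsilon> ^ (i - 1) * s' i J \<tau> y) has_real_derivative gx' J \<tau> x \<epsilon>) (at x)"
      by (simp add: s'_def)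
    have "((\<lambda>t. (\<Sum>i=1..n. \<epsilon> ^ (i - 1) * s i J t x) + \<epsilon> ^ n * u J t x) has_real_derivative g\<tau>' J \<tau> x \<epsilon>) (at \<tau>)"
      unfolding g\<tau>'_def by (intro DERIV_add DERIV_cmult normal_formD(8)[OF nf] u J)
    then show "((\<lambda>t. \<Sum>i=1..Suc n. \<epsilon> ^ (i - 1) * s' i J t x) has_real_derivative g\<tau>' J \<tau> x \<epsilon>) (at \<tau>)"
      by (simp add: s'_def)
    have k_eq: "k I \<tau> = pi\<^sup>2 / (d \<tau>)\<^sup>2" for I
      using d_pos[of \<tau>] by (simp add: k_def power2_eq_square field_simps)
    have energy: "energy d I \<tau> = k J \<tau> * I\<^sup>2 / 2" for I
      by (simp add: energy_def k_eq)
    have drift: "I * deriv d \<tau> / d \<tau> = I * w J \<tau>" for I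
      by (simp add: w_def divide_inverse)
    have hom: "k J \<tau> * J * ux J \<tau> x \<epsilon> = m J \<tau> - \<rho>0 J \<tau> x"
      unfolding k_eq by (rule u(8)[OF J])
    have "(\<Sum>i=1..Suc n. \<epsilon> ^ i * h' i J \<tau>) = (\<Sum>i=1..n. \<epsilon> ^ i * h i J \<tau>) + \<epsilon> * \<epsilon> ^ n * m J \<tau>"
      by (simp add: h'_def)
    then show "energy d (J + \<epsilon> * gx' J \<tau> x \<epsilon>) \<tau>
        - \<epsilon> * ((J + \<epsilon> * gx' J \<tau> x \<epsilon>) * deriv d \<tau> / d \<tau>) * x + \<epsilon>\<^sup>2 * g\<tau>' J \<tau> x \<epsilon> =
      energy d J \<tau> + (\<Sum>i=1..Suc n. \<epsilon> ^ i * h' i J \<tau>) + \<epsilon> ^ Suc (Suc n) * \<rho>' J \<tau> x \<epsilon>"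
      using energy_shift[OF normal_formD(9)[OF nf J, of \<epsilon> \<tau> x,
            unfolded energy drift \<rho>(3) power_Suc] hom, of "u\<tau> J \<tau> x \<epsilon>"]
      unfolding energy drift gx'_def g\<tau>'_def \<rho>'_def power_Suc by simp
  qed
  then show ?thesis by blast
qed

lemma normal_form_exists: "\<exists>s h gx g\<tau> \<rho>. normal_form n s h gx g\<tau> \<rho>"
proof (induction n)
  case 0
  \<comment> \<open>With the identity change of variables, the remainder is the perturbation of the Hamiltonian itself.\<close>
  define \<rho> :: symbol where "\<rho> = (\<lambda>J \<tau> x \<epsilon>. (-1) * (J * (deriv d \<tau> * inverse (d \<tau>))) * x)"
  have "angle_poly \<rho>"
    unfolding \<rho>_def by (intro angle_poly_times angle_poly_angle angle_poly_coefficient coefficient.intros coefficient_wall)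
  moreover have "angle_poly (\<lambda>J \<tau> x \<epsilon>. 0)"
    by (rule angle_poly_coefficient[OF const])
  ultimately have "normal_form 0 (\<lambda>_ _ _ _. 0) (\<lambda>_ _ _. 0) (\<lambda>_ _ _ _. 0) (\<lambda>_ _ _ _. 0) \<rho>"
    unfolding normal_form_def by (simp add: \<rho>_def divide_inverse)
  then show ?case by blast
next
  case (Suc n)
  then show ?case using normal_form_step by blast
qed

end

section \<open>Uniformity on compact sets of actions\<close>

lemma compact_pos_subset_interval:
  fixes K :: "real set"
  assumes "compact K" "K \<subseteq> {0<..}"
  obtains a b where "0 < a" "K \<subseteq> {a<..<b}"
proof (cases "K = {}")
  case True
  then show ?thesis using that[of 1 1] by simp
next
  case False
  then obtain l u where "l \<in> K" "\<forall>x\<in>K. l \<le> x" "\<forall>x\<in>K. x \<le> u"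
    using compact_attains_inf[OF assms(1)] compact_attains_sup[OF assms(1)] by blast
  then show ?thesis
    using assms(2) by (intro that[of "l / 2" "u + 1"]) fastforce+
qed

theorem theorem1:
  fixes d :: "real \<Rightarrow> real" and c :: real and r :: nat
  assumes "smooth_on UNIV d"
    and "c > 0" and "\<And>\<tau>. d \<tau> \<ge> c"
    and "r \<ge> 1"
  shows "\<exists>(S :: nat \<Rightarrow> real \<Rightarrow> real \<Rightarrow> real \<Rightarrow> real) (h :: nat \<Rightarrow> real \<Rightarrow> real \<Rightarrow> real)
            (R :: real \<Rightarrow> real \<Rightarrow> real \<Rightarrow> real \<Rightarrow> real).
     (\<forall>i\<in>{1..r-1}.
        (\<forall>\<phi>. smooth_on ({0<..} \<times> UNIV) (\<lambda>(J, \<tau>). S i J \<phi> \<tau>)) \<and>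
        (\<forall>J>0. \<forall>\<tau>. continuous_on UNIV (\<lambda>\<phi>. S i J \<phi> \<tau>)) \<and>
        (\<forall>J>0. \<forall>\<phi> \<tau>. S i J (\<phi> + 2 * pi) \<tau> = S i J \<phi> \<tau>) \<and>
        smooth_on ({0<..} \<times> UNIV) (\<lambda>(J, \<tau>). h i J \<tau>)) \<and>
     (\<forall>K T. compact K \<and> K \<subseteq> {0<..} \<and> admissible_times d T \<longrightarrow>
        (\<exists>\<epsilon>0>0. \<exists>C. \<forall>\<epsilon>. 0 < \<epsilon> \<and> \<epsilon> < \<epsilon>0 \<longrightarrow> (\<forall>\<tau>\<in>T.
           generates_canonical_change (generating_sum r S) \<tau> \<epsilon> K \<and>
           (\<forall>J\<in>K. \<forall>\<psi>. let \<phi> = old_angle (generating_sum r S) \<tau> \<epsilon> J \<psi> in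
              \<phi> \<notin> jump_angles \<longrightarrow>
                new_hamiltonian d (generating_sum r S) J \<phi> \<tau> \<epsilon> =
                  truncated_hamiltonian d r h J \<tau> \<epsilon> + \<epsilon> ^ r * R J \<phi> \<tau> \<epsilon> \<and>
                \<bar>R J \<phi> \<tau> \<epsilon>\<bar> \<le> C))))"
proof -
  interpret moving_wall d c
    using assms by unfold_locales auto
  obtain s h gx g\<tau> \<rho> where nf: "normal_form (r - 1) s h gx g\<tau> \<rho>"
    using normal_form_exists by blast
  define S :: "nat \<Rightarrow> real \<Rightarrow> real \<Rightarrow> real \<Rightarrow> real" where "S = (\<lambda>i J \<phi> \<tau>. s i J \<tau> (wrap \<phi>))"
  define R :: "real \<Rightarrow> real \<Rightarrow> real \<Rightarrow> real \<Rightarrow> real" where "R = (\<lambda>J \<phi> \<tau> \<epsilon>. \<rho> J \<tau> (wrap \<phi>) \<epsilon>)"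
  define g :: symbol where "g = (\<lambda>J \<tau> x \<epsilon>. \<Sum>i=1..r-1. \<epsilon> ^ (i - 1) * s i J \<tau> x)"
  have generating_sum: "generating_sum r S J \<phi> \<tau> \<epsilon> = g J \<tau> (wrap \<phi>) \<epsilon>" for J \<phi> \<tau> \<epsilon>
    by (simp add: generating_sum_def g_def S_def)
  have "angle_poly g"
    unfolding g_def
    by (intro angle_poly_sum angle_poly_times angle_poly_eps_power normal_formD(1)[OF nf]) auto
  then obtain g\<tau>' gJ gx' gJJ gJx gxx where jet: "second_jet g g\<tau>' gJ gx' gJJ gJx gxx"
    using angle_poly_second_jet by blast
  have regular: "\<forall>i\<in>{1..r-1}.
        (\<forall>\<phi>. smooth_on ({0<..} \<times> UNIV) (\<lambda>(J, \<tau>). S i J \<phi> \<tau>)) \<and>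
        (\<forall>J>0. \<forall>\<tau>. continuous_on UNIV (\<lambda>\<phi>. S i J \<phi> \<tau>)) \<and>
        (\<forall>J>0. \<forall>\<phi> \<tau>. S i J (\<phi> + 2 * pi) \<tau> = S i J \<phi> \<tau>) \<and>
        smooth_on ({0<..} \<times> UNIV) (\<lambda>(J, \<tau>). h i J \<tau>)"
  proof (intro ballI conjI allI impI)
    fix i assume i: "i \<in> {1..r-1}"
    show "smooth_on ({0<..} \<times> UNIV) (\<lambda>(J, \<tau>). S i J \<phi> \<tau>)" for \<phi>
      unfolding S_def
      by (intro coefficient_smooth coefficient_angle_poly[OF normal_formD(1)[OF nf i]])
    show "S i J (\<phi> + 2 * pi) \<tau> = S i J \<phi> \<tau>" for J \<phi> \<tau>
      by (simp add: S_def)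
    show "smooth_on ({0<..} \<times> UNIV) (\<lambda>(J, \<tau>). h i J \<tau>)"
      by (intro coefficient_smooth normal_formD(3)[OF nf i])
    fix J \<tau> :: real
    have "continuous_on {-pi..pi} (s i J \<tau>)"
      by (rule continuous_on_angle_poly[OF normal_formD(1)[OF nf i]])
    then show "continuous_on UNIV (\<lambda>\<phi>. S i J \<phi> \<tau>)"
      unfolding S_def by (rule continuous_on_wrap[OF _ normal_formD(2)[OF nf i]])
  qed
  have hamiltonian_eq: "new_hamiltonian d (generating_sum r S) J \<phi> \<tau> \<epsilon> =
      truncated_hamiltonian d r h J \<tau> \<epsilon> + \<epsilon> ^ r * R J \<phi> \<tau> \<epsilon>"
    if J: "J > 0" and \<phi>: "\<phi> \<notin> jump_angles" for J \<phi> \<tau> \<epsilon>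
  proof -
    have "((\<lambda>\<theta>. g J \<tau> (wrap \<theta>) \<epsilon>) has_real_derivative gx J \<tau> (wrap \<phi>) \<epsilon>) (at \<phi>)"
      unfolding g_def by (rule DERIV_wrap[OF \<phi> normal_formD(7)[OF nf J]])
    then have "old_action (generating_sum r S) \<tau> \<epsilon> J \<phi> = J + \<epsilon> * gx J \<tau> (wrap \<phi>) \<epsilon>"
      by (simp add: old_action_def generating_sum DERIV_imp_deriv)
    moreover have "deriv (\<lambda>t. generating_sum r S J \<phi> t \<epsilon>) \<tau> = g\<tau> J \<tau> (wrap \<phi>) \<epsilon>"
      unfolding generating_sum g_def by (rule DERIV_imp_deriv[OF normal_formD(8)[OF nf J]])
    ultimately show ?thesis
      using normal_formD(9)[OF nf J, of \<epsilon> \<tau> "wrap \<phi>"] \<open>r \<ge> 1\<close> sawtooth_eq_wrap[OF \<phi>]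
      by (simp add: new_hamiltonian_def hamiltonian_def truncated_hamiltonian_def energy_def R_def)
  qed
  have uniform: "\<forall>K T. compact K \<and> K \<subseteq> {0<..} \<and> admissible_times d T \<longrightarrow>
        (\<exists>\<epsilon>0>0. \<exists>C. \<forall>\<epsilon>. 0 < \<epsilon> \<and> \<epsilon> < \<epsilon>0 \<longrightarrow> (\<forall>\<tau>\<in>T.
           generates_canonical_change (generating_sum r S) \<tau> \<epsilon> K \<and>
           (\<forall>J\<in>K. \<forall>\<psi>. let \<phi> = old_angle (generating_sum r S) \<tau> \<epsilon> J \<psi> in
              \<phi> \<notin> jump_angles \<longrightarrow>
                new_hamiltonian d (generating_sum r S) J \<phi> \<tau> \<epsilon> =
                  truncated_hamiltonian d r h J \<tau> \<epsilon> + \<epsilon> ^ r * R J \<phi> \<tau> \<epsilon> \<and>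
                \<bar>R J \<phi> \<tau> \<epsilon>\<bar> \<le> C)))"
  proof (intro allI impI)
    fix K T :: "real set"
    assume "compact K \<and> K \<subseteq> {0<..} \<and> admissible_times d T"
    then have K: "compact K" "K \<subseteq> {0<..}" and T: "admissible_times d T" by auto
    obtain a b where ab: "0 < a" "K \<subseteq> {a<..<b}"
      using compact_pos_subset_interval[OF K] .
    let ?box = "\<lambda>J \<tau> x \<epsilon>. a \<le> J \<and> J \<le> b \<and> \<tau> \<in> T \<and> -pi \<le> x \<and> x \<le> pi \<and> 0 \<le> \<epsilon> \<and> \<epsilon> \<le> 1"
    have bounded: "\<exists>B>0. \<forall>J \<tau> x \<epsilon>. ?box J \<tau> x \<epsilon> \<longrightarrow> \<bar>q J \<tau> x \<epsilon>\<bar> < B" if q: "angle_poly q" for q :: symbol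
    proof -
      obtain B where B: "\<And>J \<tau> x \<epsilon>. \<lbrakk>a \<le> J; J \<le> b; \<tau> \<in> T; -pi \<le> x; x \<le> pi; 0 \<le> \<epsilon>; \<epsilon> \<le> 1\<rbrakk>
          \<Longrightarrow> \<bar>q J \<tau> x \<epsilon>\<bar> \<le> B"
        using angle_poly_bounded[OF q ab(1) T, of b] by blast
      have "\<bar>q J \<tau> x \<epsilon>\<bar> < \<bar>B\<bar> + 1" if "?box J \<tau> x \<epsilon>" for J \<tau> x \<epsilon>
        using B[of J \<tau> x \<epsilon>] that by linarith
      then show ?thesis by (intro exI[of _ "\<bar>B\<bar> + 1"]) auto
    qed
    obtain B where B: "B > 0" "\<And>J \<tau> x \<epsilon>. ?box J \<tau> x \<epsilon> \<Longrightarrow> \<bar>gJx J \<tau> x \<epsilon>\<bar> < B"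
      using bounded[OF second_jetD(5)[OF jet]] by blast
    obtain B' where B': "B' > 0" "\<And>J \<tau> x \<epsilon>. ?box J \<tau> x \<epsilon> \<Longrightarrow> \<bar>gx' J \<tau> x \<epsilon>\<bar> < B'"
      using bounded[OF second_jetD(3)[OF jet]] by blast
    obtain C where C: "C > 0" "\<And>J \<tau> x \<epsilon>. ?box J \<tau> x \<epsilon> \<Longrightarrow> \<bar>\<rho> J \<tau> x \<epsilon>\<bar> < C"
      using bounded[OF normal_formD(6)[OF nf]] by blast
    \<comment> \<open>The bound \<open>1/B\<close> makes the generating relations solvable, \<open>a/B'\<close> keeps the old action positive;
      the bounds themselves are for \<open>\<epsilon> \<le> 1\<close>.\<close>
    define \<epsilon>0 where "\<epsilon>0 = min 1 (min (1 / B) (a / B'))"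
    have \<epsilon>0: "\<epsilon>0 > 0" using ab B(1) B'(1) by (simp add: \<epsilon>0_def)
    show "\<exists>\<epsilon>0>0. \<exists>C. \<forall>\<epsilon>. 0 < \<epsilon> \<and> \<epsilon> < \<epsilon>0 \<longrightarrow> (\<forall>\<tau>\<in>T.
           generates_canonical_change (generating_sum r S) \<tau> \<epsilon> K \<and>
           (\<forall>J\<in>K. \<forall>\<psi>. let \<phi> = old_angle (generating_sum r S) \<tau> \<epsilon> J \<psi> in
              \<phi> \<notin> jump_angles \<longrightarrow>
                new_hamiltonian d (generating_sum r S) J \<phi> \<tau> \<epsilon> =
                  truncated_hamiltonian d r h J \<tau> \<epsilon> + \<epsilon> ^ r * R J \<phi> \<tau> \<epsilon> \<and>
                \<bar>R J \<phi> \<tau> \<epsilon>\<bar> \<le> C))"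
      unfolding Let_def
    proof (rule exI[of _ \<epsilon>0], rule conjI[OF \<epsilon>0], rule exI[of _ C], intro allI impI ballI conjI)
      fix \<epsilon> \<tau> assume "0 < \<epsilon> \<and> \<epsilon> < \<epsilon>0" and \<tau>: "\<tau> \<in> T"
      then have \<epsilon>: "0 < \<epsilon>" "\<epsilon> < \<epsilon>0" by auto
      have \<epsilon>': "\<epsilon> \<le> 1" "\<epsilon> * B < 1" "\<epsilon> * B' < a"
        using \<epsilon> B(1) B'(1) by (auto simp: \<epsilon>0_def field_simps)
      show "generates_canonical_change (generating_sum r S) \<tau> \<epsilon> K"
      proof (rule wrapped_generating_function_is_canonical
            [where s = "\<lambda>J x. g J \<tau> x \<epsilon>" and sJ = "\<lambda>J x. gJ J \<tau> x \<epsilon>" and sx = "\<lambda>J x. gx' J \<tau> x \<epsilon>" and sJJ = "\<lambda>J x. gJJ J \<tau> x \<epsilon>"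
            and sJx = "\<lambda>J x. gJx J \<tau> x \<epsilon>" and sxx = "\<lambda>J x. gxx J \<tau> x \<epsilon>" and a = a and b = b])
        show "generating_sum r S J \<phi> \<tau> \<epsilon> = g J \<tau> (wrap \<phi>) \<epsilon>" for J \<phi>
          by (rule generating_sum)
        show "0 < a" "K \<subseteq> {a<..<b}" by (fact ab)+
      next
        fix J x :: real assume J: "0 < J"
        show "has_gradient (\<lambda>J x. g J \<tau> x \<epsilon>) (gJ J \<tau> x \<epsilon>) (gx' J \<tau> x \<epsilon>) J x"
          "has_gradient (\<lambda>J x. gJ J \<tau> x \<epsilon>) (gJJ J \<tau> x \<epsilon>) (gJx J \<tau> x \<epsilon>) J x"
          "has_gradient (\<lambda>J x. gx' J \<tau> x \<epsilon>) (gJx J \<tau> x \<epsilon>) (gxx J \<tau> x \<epsilon>) J x"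
          using second_jetD(8-10)[OF jet J] by blast+
        show "g J \<tau> pi \<epsilon> = g J \<tau> (-pi) \<epsilon>"
          unfolding g_def using normal_formD(2)[OF nf] by (intro sum.cong) auto
      next
        fix J x assume box: "a \<le> J" "J \<le> b" "-pi \<le> x" "x \<le> pi"
        have "\<epsilon> * \<bar>gJx J \<tau> x \<epsilon>\<bar> \<le> \<epsilon> * B" "\<epsilon> * \<bar>gx' J \<tau> x \<epsilon>\<bar> \<le> \<epsilon> * B'"
          using B(2)[of J \<tau> x \<epsilon>] B'(2)[of J \<tau> x \<epsilon>] box \<tau> \<epsilon> \<epsilon>' by (auto intro!: mult_left_mono)
        then have "\<epsilon> * \<bar>gJx J \<tau> x \<epsilon>\<bar> < 1" "\<epsilon> * \<bar>gx' J \<tau> x \<epsilon>\<bar> < a"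
          using \<epsilon>' by linarith+
        then show "\<bar>\<epsilon> * gJx J \<tau> x \<epsilon>\<bar> < 1" "\<bar>\<epsilon> * gx' J \<tau> x \<epsilon>\<bar> < a"
          using \<epsilon> by (simp_all add: abs_mult)
      qed
      fix J \<psi>
      let ?\<phi> = "old_angle (generating_sum r S) \<tau> \<epsilon> J \<psi>"
      assume J: "J \<in> K" and \<phi>: "?\<phi> \<notin> jump_angles"
      show "new_hamiltonian d (generating_sum r S) J ?\<phi> \<tau> \<epsilon> =
          truncated_hamiltonian d r h J \<tau> \<epsilon> + \<epsilon> ^ r * R J ?\<phi> \<tau> \<epsilon>"
        using J ab \<phi> by (intro hamiltonian_eq) auto
      have "?box J \<tau> (wrap ?\<phi>) \<epsilon>"
        using J ab wrap_off_jumps[OF \<phi>] \<tau> \<epsilon> \<epsilon>' by auto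
      then show "\<bar>R J ?\<phi> \<tau> \<epsilon>\<bar> \<le> C"
        using C(2) by (fastforce simp: R_def)
    qed
  qed
  show ?thesis
    by (rule exI[of _ S], rule exI[of _ h], rule exI[of _ R], rule conjI[OF regular uniform])
qed

end
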